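(* Let $\Omega$ be a base space of locally integrable matrix functions as in the context. Let $\mu$ be a fast growth rate and let $\omega\in\Omega$ be such that the equation $\dot x=A(\omega_t)x$ has (uniform) exponential bounded growth. Then $\Sigma_{\mathrm{N}\mu\mathrm{D}}(\widehat\omega)=\Sigma_{\mu\mathrm{D}}(\widehat\omega)=\{0\}$ for every $\widehat\omega\in\mathbb{H}(\omega)$.
   Context: Skew-product setting. $N\ge1$ and $\Omega$ is a space of locally integrable functions $\omega:\mathbb{R}\to\mathbb{R}^{N\times N}$, endowed with a topology such that the translation flow $\mathbb{R}\times\Omega\to\Omega$, $(\tau,\omega)\mapsto\omega_\tau$, $\omega_\tau(t)=\omega(t+\tau)$, is well defined and continuous; the evaluation map $A:\Omega\to\mathbb{R}^{N\times N}$, $A(\omega)=\omega(0)$, is continuous (so $A(\omega_t)=\omega(t)$); if $\widehat\omega=\lim_n\omega_{\tau_n}$ in $\Omega$ with $\tau_n\searrow-\infty$ or $\tau_n\nearrow+\infty$, then $\widehat\omega(t)=\lim_n\omega_{\tau_n}(t)$ for almost every $t$; and $(\omega,t,s)\mapsto\Phi_\omega(t,s)$ is jointly continuous, where $\Phi_\omega(t,s)$ denotes the evolution operator of $\dot x=A(\omega_t)x$. The hull $\mathbb{H}(\omega)$ is the closure in $\Omega$ of the orbit $\{\omega_\tau:\tau\in\mathbb{R}\}$. The equation $\dot x=A(\omega_t)x$ has exponential bounded growth if there are $L\ge1$, $a>0$ with $\|\Phi_\omega(t,s)\|\le Le^{a|t-s|}$ for all $t,s\in\mathbb{R}$. Growth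 rates. A growth rate is a strictly increasing differentiable function $\mu:\mathbb{R}\to\mathbb{R}^+$ with $\mu(0)=1$, $\lim_{t\to+\infty}\mu(t)=+\infty$, $\lim_{t\to-\infty}\mu(t)=0$. For $r>1$ let $\mathrm{s}_r(t)=e^{\mathrm{sgn}(t)|t|^r}$. The growth rate $\mu$ is fast if there are $r\in(1,+\infty)$ and $M\ge1$ with $\frac{\mathrm{s}_r(t)}{\mathrm{s}_r(s)}\le M\frac{\mu(t)}{\mu(s)}$ for all $t\ge s$. Dichotomy. $\dot x=B(t)x$ ($B$ locally integrable, evolution operator $\Phi$) has nonuniform $\mu$-dichotomy with projector $\mathrm{P}$ if $\mathrm{P}(s)$, $s\in\mathbb{R}$, are projections with $\mathrm{P}(t)\Phi(t,s)=\Phi(t,s)\mathrm{P}(s)$ for all $t,s$, and there are $K\ge1$, $\alpha<0$, $\beta>0$, $\theta,\nu\ge0$ with $\alpha+\theta<0$, $\beta-\nu>0$ such that $\|\Phi(t,s)\mathrm{P}(s)\|\le K(\mu(t)/\mu(s))^\alpha\mu(s)^{\mathrm{sgn}(s)\theta}$ for $t\ge s$ and $\|\Phi(t,s)[\mathrm{Id}-\mathrm{P}(s)]\|\le K(\mu(t)/\mu(s))^\beta\mu(s)^{\mathrm{sgn}(s)\nu}$ for $t\le s$. It has uniform $\mu$-dichotomy if this holds with $\theta=\nu=0$. Spectra. Let $\overline{\mathbb{R}}=\mathbb{R}\cup\{\pm\infty\}$. For $\gamma\in\mathbb{R}$ consider the shifted equation $\dot y=\big(\widehat\omega(t)-\gamma\frac{\dot\mu(t)}{\mu(t)}\mathrm{Id}\big)y$.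 By convention it "has dichotomy for $\gamma=+\infty$" (resp. $\gamma=-\infty$) if for some real $\widehat\gamma$ the shifted equation with $\gamma=\widehat\gamma$ has the dichotomy with $\mathrm{P}\equiv\mathrm{Id}$ (resp. $\mathrm{P}\equiv0$). Then $\Sigma_{\mathrm{N}\mu\mathrm{D}}(\widehat\omega)$ (resp. $\Sigma_{\mu\mathrm{D}}(\widehat\omega)$) is the set of $\gamma\in\overline{\mathbb{R}}$ for which the shifted equation does not have nonuniform (resp. uniform) $\mu$-dichotomy. *)

theory Defs
  imports "HOL-Analysis.Analysis"
begin

type_synonym 'n coeff = "real \<Rightarrow> real^'n^'n"

definition locally_integrable :: "'n::finite coeff \<Rightarrow> bool" where
  "locally_integrable B \<longleftrightarrow> (\<forall>a b. B absolutely_integrable_on {a..b})"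

(* The norm instance on real^'n^'n is the Euclidean norm of the entries; bounds on evolution
   operators are stated in the operator norm instead. *)
definition opnorm :: "real^'n^'n::finite \<Rightarrow> real" where
  "opnorm M = onorm (\<lambda>x. M *v x)"

(* Caratheodory solution of X' = B(t) X, X(s) = Id, in integrated form (Lebesgue integral). *)
definition is_fundamental_solution :: "'n::finite coeff \<Rightarrow> real \<Rightarrow> 'n coeff \<Rightarrow> bool" where
  "is_fundamental_solution B s X \<longleftrightarrow>
     X s = mat 1 \<and>
     (\<forall>a b. a \<le> b \<longrightarrow>
        (\<lambda>\<tau>. B \<tau> ** X \<tau>) absolutely_integrable_on {a..b} \<and>
        X b - X a = integral {a..b} (\<lambda>\<tau>. B \<tau> ** X \<tau>))"

(* For locally integrable B there is exactly one such X, so the description is proper. *)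
definition evolution :: "'n::finite coeff \<Rightarrow> real \<Rightarrow> real \<Rightarrow> real^'n^'n" where
  "evolution B t s = (THE X. is_fundamental_solution B s X) t"

definition translate :: "real \<Rightarrow> 'n::finite coeff \<Rightarrow> 'n coeff" where
  "translate \<tau> \<omega> = (\<lambda>t. \<omega> (t + \<tau>))"

definition evalA :: "'n::finite coeff \<Rightarrow> real^'n^'n" where
  "evalA \<omega> = \<omega> 0"

definition Phi :: "'n::finite coeff \<Rightarrow> real \<Rightarrow> real \<Rightarrow> real^'n^'n" where
  "Phi \<omega> = evolution (\<lambda>t. evalA (translate t \<omega>))"

(* The carrier of the base space is topspace T. *)
definition base_space :: "('n::finite coeff) topology \<Rightarrow> bool" where
  "base_space T \<longleftrightarrow>
     (\<forall>\<omega>\<in>topspace T. locally_integrable \<omega>) \<and>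
     continuous_map (prod_topology euclideanreal T) T (\<lambda>(\<tau>, \<omega>). translate \<tau> \<omega>) \<and>
     continuous_map T euclidean evalA \<and>
     (\<forall>\<omega>\<in>topspace T. \<forall>\<eta> (\<tau> :: nat \<Rightarrow> real).
        (decseq \<tau> \<and> filterlim \<tau> at_bot sequentially \<or>
         incseq \<tau> \<and> filterlim \<tau> at_top sequentially) \<longrightarrow>
        limitin T (\<lambda>n. translate (\<tau> n) \<omega>) \<eta> sequentially \<longrightarrow>
        (AE t in lebesgue. (\<lambda>n. translate (\<tau> n) \<omega> t) \<longlonglongrightarrow> \<eta> t)) \<and>
     continuous_map (prod_topology T (prod_topology euclideanreal euclideanreal)) euclidean
       (\<lambda>(\<omega>, t, s). Phi \<omega> t s)"

definition orbit_hull :: "('n::finite coeff) topology \<Rightarrow> 'n coeff \<Rightarrow> 'n coeff set" where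
  "orbit_hull T \<omega> = T closure_of (range (\<lambda>\<tau>. translate \<tau> \<omega>))"

definition exp_bounded_growth :: "'n::finite coeff \<Rightarrow> bool" where
  "exp_bounded_growth \<omega> \<longleftrightarrow>
     (\<exists>L\<ge>1. \<exists>a>0. \<forall>t s. opnorm (Phi \<omega> t s) \<le> L * exp (a * \<bar>t - s\<bar>))"

definition growth_rate :: "(real \<Rightarrow> real) \<Rightarrow> bool" where
  "growth_rate \<mu> \<longleftrightarrow>
     strict_mono \<mu> \<and> (\<forall>t. \<mu> differentiable at t) \<and> (\<forall>t. \<mu> t > 0) \<and> \<mu> 0 = 1 \<and>
     filterlim \<mu> at_top at_top \<and> (\<mu> \<longlongrightarrow> 0) at_bot"

definition s_rate :: "real \<Rightarrow> real \<Rightarrow> real" where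
  "s_rate r t = exp (sgn t * \<bar>t\<bar> powr r)"

definition fast_growth_rate :: "(real \<Rightarrow> real) \<Rightarrow> bool" where
  "fast_growth_rate \<mu> \<longleftrightarrow>
     growth_rate \<mu> \<and>
     (\<exists>r>1. \<exists>M\<ge>1. \<forall>t s. t \<ge> s \<longrightarrow> s_rate r t / s_rate r s \<le> M * (\<mu> t / \<mu> s))"

definition invariant_projector :: "'n::finite coeff \<Rightarrow> 'n coeff \<Rightarrow> bool" where
  "invariant_projector B P \<longleftrightarrow>
     (\<forall>s. P s ** P s = P s) \<and>
     (\<forall>t s. P t ** evolution B t s = evolution B t s ** P s)"

definition dichotomy_bounds ::
  "(real \<Rightarrow> real) \<Rightarrow> 'n::finite coeff \<Rightarrow> 'n coeff
    \<Rightarrow> real \<Rightarrow> real \<Rightarrow> real \<Rightarrow> real \<Rightarrow> real \<Rightarrow> bool" where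
  "dichotomy_bounds \<mu> B P K \<alpha> \<beta> \<theta> \<nu> \<longleftrightarrow>
     (\<forall>t s. t \<ge> s \<longrightarrow> opnorm (evolution B t s ** P s)
        \<le> K * (\<mu> t / \<mu> s) powr \<alpha> * \<mu> s powr (sgn s * \<theta>)) \<and>
     (\<forall>t s. t \<le> s \<longrightarrow> opnorm (evolution B t s ** (mat 1 - P s))
        \<le> K * (\<mu> t / \<mu> s) powr \<beta> * \<mu> s powr (sgn s * \<nu>))"

definition nonuniform_dichotomy ::
  "(real \<Rightarrow> real) \<Rightarrow> 'n::finite coeff \<Rightarrow> 'n coeff \<Rightarrow> bool" where
  "nonuniform_dichotomy \<mu> B P \<longleftrightarrow>
     invariant_projector B P \<and>
     (\<exists>K \<alpha> \<beta> \<theta> \<nu>. K \<ge> 1 \<and> \<alpha> < 0 \<and> \<beta> > 0 \<and> \<theta> \<ge> 0 \<and> \<nu> \<ge> 0 \<and>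
        \<alpha> + \<theta> < 0 \<and> \<beta> - \<nu> > 0 \<and> dichotomy_bounds \<mu> B P K \<alpha> \<beta> \<theta> \<nu>)"

definition uniform_dichotomy ::
  "(real \<Rightarrow> real) \<Rightarrow> 'n::finite coeff \<Rightarrow> 'n coeff \<Rightarrow> bool" where
  "uniform_dichotomy \<mu> B P \<longleftrightarrow>
     invariant_projector B P \<and>
     (\<exists>K \<alpha> \<beta>. K \<ge> 1 \<and> \<alpha> < 0 \<and> \<beta> > 0 \<and> dichotomy_bounds \<mu> B P K \<alpha> \<beta> 0 0)"

definition shifted :: "(real \<Rightarrow> real) \<Rightarrow> 'n::finite coeff \<Rightarrow> real \<Rightarrow> 'n coeff" where
  "shifted \<mu> \<omega> \<gamma> = (\<lambda>t. \<omega> t - (\<gamma> * (deriv \<mu> t / \<mu> t)) *\<^sub>R mat 1)"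

(* D B P is read as "the equation with coefficient B has the dichotomy with projector P". *)
definition shifted_has_dichotomy ::
  "('n::finite coeff \<Rightarrow> 'n coeff \<Rightarrow> bool) \<Rightarrow> (real \<Rightarrow> real) \<Rightarrow> 'n coeff \<Rightarrow> ereal \<Rightarrow> bool" where
  "shifted_has_dichotomy D \<mu> \<omega> \<gamma> =
     (case \<gamma> of
        ereal g \<Rightarrow> \<exists>P. D (shifted \<mu> \<omega> g) P
      | PInfty \<Rightarrow> \<exists>g. D (shifted \<mu> \<omega> g) (\<lambda>_. mat 1)
      | MInfty \<Rightarrow> \<exists>g. D (shifted \<mu> \<omega> g) (\<lambda>_. 0))"

definition spectrum_NmuD :: "(real \<Rightarrow> real) \<Rightarrow> 'n::finite coeff \<Rightarrow> ereal set" where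
  "spectrum_NmuD \<mu> \<omega> = {\<gamma>. \<not> shifted_has_dichotomy (nonuniform_dichotomy \<mu>) \<mu> \<omega> \<gamma>}"

definition spectrum_muD :: "(real \<Rightarrow> real) \<Rightarrow> 'n::finite coeff \<Rightarrow> ereal set" where
  "spectrum_muD \<mu> \<omega> = {\<gamma>. \<not> shifted_has_dichotomy (uniform_dichotomy \<mu>) \<mu> \<omega> \<gamma>}"

end

theory Submission
  imports Defs
begin

text \<open>Exponential bounded growth is a closed condition on \<open>\<omega>\<close> for each pair \<open>(t, s)\<close>, so it passes
  with the same constants from the translates of \<open>\<omega>\<close> to the whole hull. For a fast rate every
  exponential \<open>exp (a * (t - s))\<close> is dominated by any positive power of \<open>\<mu> t / \<mu> s\<close>, while the
  shift by \<open>\<gamma>\<close> multiplies the evolution operator by \<open>(\<mu> t / \<mu> s) powr (- \<gamma>)\<close>. This factor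
  therefore decides: the projector is \<open>Id\<close> for \<open>\<gamma> > 0\<close> and \<open>0\<close> for \<open>\<gamma> < 0\<close>, and no dichotomy,
  even nonuniform, is possible for \<open>\<gamma> = 0\<close>. Since \<open>evolution\<close> is a description, existence and
  uniqueness of Caratheodory solutions are needed before anything can be said about it.\<close>

section \<open>Primitives of locally integrable functions\<close>

text \<open>A Caratheodory derivative in integrated form: \<open>F\<close> is locally absolutely
  continuous with density \<open>f\<close>. With \<open>f\<close> taken as \<open>B t ** F t\<close>
  this is exactly the integral equation of a fundamental solution, so rules for primitives are rules
  for solutions.\<close>

definition primitive :: "(real \<Rightarrow> 'a::euclidean_space) \<Rightarrow> (real \<Rightarrow> 'a) \<Rightarrow> bool" where
  "primitive f F \<longleftrightarrow>
     (\<forall>a b. a \<le> b \<longrightarrow> f absolutely_integrable_on {a..b} \<and> F b - F a = integral {a..b} f)"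

lemma primitive_absolutely_integrable:
  "primitive f F \<Longrightarrow> f absolutely_integrable_on {a..b}"
  by (cases "a \<le> b") (auto simp: primitive_def)

lemma primitive_integrable: "primitive f F \<Longrightarrow> f integrable_on {a..b}"
  by (meson primitive_absolutely_integrable set_lebesgue_integral_eq_integral(1))

lemma primitive_diff: "primitive f F \<Longrightarrow> a \<le> b \<Longrightarrow> F b - F a = integral {a..b} f"
  by (auto simp: primitive_def)

lemma primitive_exists:
  fixes f :: "real \<Rightarrow> 'a::euclidean_space"
  assumes "\<And>a b. f absolutely_integrable_on {a..b}"
  shows "\<exists>F. primitive f F"
proof
  have int: "f integrable_on {a..b}" for a b
    using assms set_lebesgue_integral_eq_integral(1) by blast
  have comb: "integral {a..c} f + integral {c..b} f = integral {a..b} f"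
    if "a \<le> c" "c \<le> b" for a b c
    using that int Henstock_Kurzweil_Integration.integral_combine by blast
  have empty: "integral {b..a} f = 0" if "a \<le> b" for a b
    using that by (cases "a = b") auto
  \<comment> \<open>This is the oriented integral from 0 to \<open>t\<close>: integrals over empty
    or one-point intervals are 0, so for each sign of \<open>t\<close> only one of the two terms
    survives.\<close>
  show "primitive f (\<lambda>t. integral {0..t} f - integral {t..0} f)"
    unfolding primitive_def
  proof (intro allI impI conjI assms)
    fix a b :: real
    assume "a \<le> b"
    then consider "0 \<le> a" | "a \<le> 0" "0 \<le> b" | "b \<le> 0" by linarith
    then show "integral {0..b} f - integral {b..0} f - (integral {0..a} f - integral {a..0} f)
        = integral {a..b} f"
    proof cases
      case 1
      then show ?thesis
        using comb[of 0 a b] empty[of 0 a] empty[of 0 b] \<open>a \<le> b\<close> by (simp add: algebra_simps)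
    next
      case 2
      then show ?thesis
        using comb[of a 0 b] empty[of a 0] empty[of 0 b] by (simp add: algebra_simps)
    next
      case 3
      then show ?thesis
        using comb[of a b 0] empty[of a 0] empty[of b 0] \<open>a \<le> b\<close> by (simp add: algebra_simps)
    qed
  qed
qed

lemma primitive_continuous_on:
  assumes "primitive f F"
  shows "continuous_on A F"
proof -
  have "isCont F x" for x
  proof -
    have "continuous_on {x-1..x+1} (\<lambda>t. F (x-1) + integral {x-1..t} f)"
      by (intro continuous_intros indefinite_integral_continuous_1 primitive_integrable[OF assms])
    moreover have "F (x-1) + integral {x-1..t} f = F t" if "t \<in> {x-1..x+1}" for t
      using primitive_diff[OF assms, of "x-1" t] that by (simp add: algebra_simps)
    ultimately have "continuous_on {x-1..x+1} F"
      by (rule continuous_on_eq)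
    then show ?thesis
      by (rule continuous_on_interior) auto
  qed
  then show ?thesis
    by (simp add: continuous_at_imp_continuous_on)
qed

lemma primitive_isCont: "primitive f F \<Longrightarrow> isCont F x"
  using primitive_continuous_on[of f F UNIV] by (simp add: continuous_on_eq_continuous_at)

lemma primitive_add:
  assumes "primitive f F" "primitive g G"
  shows "primitive (\<lambda>t. f t + g t) (\<lambda>t. F t + G t)"
  unfolding primitive_def
proof (intro allI impI conjI)
  fix a b :: real
  assume "a \<le> b"
  show "(\<lambda>t. f t + g t) absolutely_integrable_on {a..b}"
    using assms primitive_absolutely_integrable set_integral_add(1) by blast
  show "F b + G b - (F a + G a) = integral {a..b} (\<lambda>t. f t + g t)"
    using primitive_diff[OF assms(1) \<open>a \<le> b\<close>] primitive_diff[OF assms(2) \<open>a \<le> b\<close>]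
    by (subst Henstock_Kurzweil_Integration.integral_add)
       (auto intro: primitive_integrable assms simp: algebra_simps)
qed

lemma primitive_linear:
  assumes "primitive f F" "bounded_linear h"
  shows "primitive (\<lambda>t. h (f t)) (\<lambda>t. h (F t))"
  unfolding primitive_def
proof (intro allI impI conjI)
  fix a b :: real
  assume "a \<le> b"
  show "(\<lambda>t. h (f t)) absolutely_integrable_on {a..b}"
    using absolutely_integrable_linear[OF primitive_absolutely_integrable[OF assms(1)] assms(2)]
    by (simp add: o_def)
  show "h (F b) - h (F a) = integral {a..b} (\<lambda>t. h (f t))"
    using integral_linear[OF primitive_integrable[OF assms(1)] assms(2), of a b]
      primitive_diff[OF assms(1) \<open>a \<le> b\<close>] bounded_linear.linear[OF assms(2)]
    by (simp add: o_def linear_diff[symmetric])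
qed

lemma primitive_shift:
  assumes "primitive f F"
  shows "primitive (\<lambda>t. f (t + c)) (\<lambda>t. F (t + c))"
  unfolding primitive_def
proof (intro allI impI conjI)
  fix a b :: real
  assume "a \<le> b"
  show "(\<lambda>t. f (t + c)) absolutely_integrable_on {a..b}"
    using primitive_absolutely_integrable[OF assms, of "a+c" "b+c"]
      integrable_shift_real_ivl_iff[of f c "a+c" "b+c"]
      integrable_shift_real_ivl_iff[of "\<lambda>x. norm (f x)" c "a+c" "b+c"]
    by (simp add: absolutely_integrable_on_def)
  show "F (b + c) - F (a + c) = integral {a..b} (\<lambda>t. f (t + c))"
    using primitive_diff[OF assms, of "a+c" "b+c"] integral_shift_real_ivl[of "a+c" c "b+c" f] \<open>a \<le> b\<close>
    by simp
qed

text \<open>The function \<open>m\<close> controls the increments of \<open>H\<close> to first order; bisection makes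
  the estimate global.\<close>

lemma constant_if_increments_negligible:
  fixes H :: "real \<Rightarrow> 'a::real_normed_vector" and m :: "real \<Rightarrow> real"
  assumes "a \<le> b"
    and local: "\<And>x e. e > 0 \<Longrightarrow>
      \<exists>d>0. \<forall>u v. u \<le> x \<and> x \<le> v \<and> v - u < d \<longrightarrow> norm (H v - H u) \<le> e * (m v - m u)"
  shows "H b = H a"
proof -
  have *: "norm (H b - H a) \<le> e * (m b - m a)" if "e > 0" for e
    using \<open>a \<le> b\<close>
  proof (induct rule: Bolzano)
    case (trans u v w)
    have "norm (H w - H u) \<le> norm (H w - H v) + norm (H v - H u)"
      using norm_triangle_ineq[of "H w - H v" "H v - H u"] by simp
    then show ?case
      using trans by (simp add: algebra_simps)
  next
    case (local x)
    then show ?case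
      using assms(2)[OF that, of x] by blast
  qed
  have "norm (H b - H a) \<le> 0"
  proof (rule field_le_epsilon)
    fix e :: real
    assume "e > 0"
    \<comment> \<open>The added 1 keeps the divisor positive when \<open>m b = m a\<close>.\<close>
    define k where "k = \<bar>m b - m a\<bar> + 1"
    have "k > 0" by (simp add: k_def)
    have "norm (H b - H a) \<le> (e / k) * (m b - m a)"
      using \<open>e > 0\<close> \<open>k > 0\<close> by (intro *) simp
    also have "\<dots> \<le> (e / k) * k"
      using \<open>e > 0\<close> \<open>k > 0\<close> by (intro mult_left_mono) (auto simp: k_def)
    finally show "norm (H b - H a) \<le> 0 + e"
      using \<open>k > 0\<close> by simp
  qed
  then show ?thesis by simp
qed

section \<open>Product and chain rules for primitives\<close>

text \<open>On a compact interval the continuous factor is measurable and bounded, and such a factor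
  preserves absolute integrability.\<close>

lemma absolutely_integrable_continuous_bilinear:
  fixes f :: "real \<Rightarrow> 'a::euclidean_space" and g :: "real \<Rightarrow> 'b::euclidean_space"
    and h :: "'a \<Rightarrow> 'b \<Rightarrow> 'c::euclidean_space"
  assumes "bounded_bilinear h" "continuous_on {a..b} f" "g absolutely_integrable_on {a..b}"
  shows "(\<lambda>t. h (f t) (g t)) absolutely_integrable_on {a..b}"
proof (rule absolutely_integrable_bounded_measurable_product[where h = h and f = f and g = g])
  show "bilinear h"
    using assms(1) by (simp add: bilinear_conv_bounded_bilinear)
  show "f \<in> borel_measurable (lebesgue_on {a..b})"
    using assms(2) by (intro continuous_imp_measurable_on_sets_lebesgue) auto
  show "bounded (f ` {a..b})"
    using assms(2) compact_continuous_image compact_imp_bounded by blast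
qed (use assms in auto)

lemma absolutely_integrable_bilinear_continuous:
  fixes f :: "real \<Rightarrow> 'a::euclidean_space" and g :: "real \<Rightarrow> 'b::euclidean_space"
    and h :: "'a \<Rightarrow> 'b \<Rightarrow> 'c::euclidean_space"
  assumes "bounded_bilinear h" "f absolutely_integrable_on {a..b}" "continuous_on {a..b} g"
  shows "(\<lambda>t. h (f t) (g t)) absolutely_integrable_on {a..b}"
  using absolutely_integrable_continuous_bilinear[OF bounded_bilinear.flip[OF assms(1)] assms(3,2)]
  by simp

text \<open>Integration by parts without pointwise derivatives. A primitive \<open>Q\<close> of the
  expected density is compared with \<open>h (F t) (G t)\<close>: on short intervals their
  increments differ by a small multiple of the integral of \<open>norm (f t) + norm (g t)\<close>,
  so their difference is constant.\<close>

lemma primitive_product: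
  fixes f :: "real \<Rightarrow> 'a::euclidean_space" and g :: "real \<Rightarrow> 'b::euclidean_space"
    and h :: "'a \<Rightarrow> 'b \<Rightarrow> 'c::euclidean_space"
  assumes h: "bounded_bilinear h" and f: "primitive f F" and g: "primitive g G"
  shows "primitive (\<lambda>t. h (f t) (G t) + h (F t) (g t)) (\<lambda>t. h (F t) (G t))"
proof -
  interpret bounded_bilinear h by (fact h)
  obtain K where K: "K > 0" "\<And>x y. norm (h x y) \<le> norm x * norm y * K"
    using pos_bounded by blast
  define q where "q t = h (f t) (G t) + h (F t) (g t)" for t
  have ai1: "(\<lambda>t. h (f t) (G t)) absolutely_integrable_on {a..b}" for a b
    by (rule absolutely_integrable_bilinear_continuous[OF h primitive_absolutely_integrable[OF f]
          primitive_continuous_on[OF g]])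
  have ai2: "(\<lambda>t. h (F t) (g t)) absolutely_integrable_on {a..b}" for a b
    by (rule absolutely_integrable_continuous_bilinear[OF h primitive_continuous_on[OF f]
          primitive_absolutely_integrable[OF g]])
  have q: "q absolutely_integrable_on {a..b}" for a b
    unfolding q_def by (rule set_integral_add(1)[OF ai1 ai2])
  obtain Q where Q: "primitive q Q"
    using primitive_exists q by blast
  have n: "(\<lambda>t. norm (f t) + norm (g t)) absolutely_integrable_on {a..b}" for a b
    using absolutely_integrable_norm[OF primitive_absolutely_integrable[OF f]]
      absolutely_integrable_norm[OF primitive_absolutely_integrable[OF g]]
    by (intro set_integral_add(1)) (simp_all add: o_def)
  obtain m where m: "primitive (\<lambda>t. norm (f t) + norm (g t)) m"
    using primitive_exists n by blast
  have "h (F b) (G b) - Q b = h (F a) (G a) - Q a" if "a \<le> b" for a b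
  proof (rule constant_if_increments_negligible[OF that, where m = m])
    fix x e :: real
    assume "e > 0"
    \<comment> \<open>Two points near \<open>x\<close> then have \<open>F\<close>-values, and
      likewise \<open>G\<close>-values, within \<open>2 * e' = e / K\<close>, which absorbs the
      bilinear constant \<open>K\<close>.\<close>
    define e' where "e' = e / (2 * K)"
    have "e' > 0" using \<open>e > 0\<close> K by (simp add: e'_def)
    then obtain d1 where d1: "d1 > 0" "\<And>y. dist y x < d1 \<Longrightarrow> dist (F y) (F x) < e'"
      using primitive_isCont[OF f, of x] unfolding continuous_at_eps_delta by blast
    obtain d2 where d2: "d2 > 0" "\<And>y. dist y x < d2 \<Longrightarrow> dist (G y) (G x) < e'"
      using primitive_isCont[OF g, of x] \<open>e' > 0\<close> unfolding continuous_at_eps_delta by blast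
    show "\<exists>d>0. \<forall>u v. u \<le> x \<and> x \<le> v \<and> v - u < d \<longrightarrow>
        norm (h (F v) (G v) - Q v - (h (F u) (G u) - Q u)) \<le> e * (m v - m u)"
    proof (intro exI[of _ "min d1 d2"] conjI allI impI; (elim conjE)?)
      show "min d1 d2 > 0" using d1 d2 by simp
      fix u v :: real
      assume uv: "u \<le> x" "x \<le> v" "v - u < min d1 d2"
      have F: "norm (F y - F z) \<le> e / K" if "y \<in> {u..v}" "z \<in> {u..v}" for y z
      proof -
        have "dist (F y) (F x) < e'" "dist (F z) (F x) < e'"
          using that uv by (auto intro!: d1 simp: dist_real_def)
        then have "dist (F y) (F z) < e' + e'"
          by (meson add_strict_mono dist_triangle2 le_less_trans)
        then show ?thesis by (simp add: e'_def dist_norm)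
      qed
      have G: "norm (G y - G z) \<le> e / K" if "y \<in> {u..v}" "z \<in> {u..v}" for y z
      proof -
        have "dist (G y) (G x) < e'" "dist (G z) (G x) < e'"
          using that uv by (auto intro!: d2 simp: dist_real_def)
        then have "dist (G y) (G z) < e' + e'"
          by (meson add_strict_mono dist_triangle2 le_less_trans)
        then show ?thesis by (simp add: e'_def dist_norm)
      qed
      have "u \<le> v" using uv by simp
      \<comment> \<open>Freezing \<open>G\<close> at \<open>v\<close> and \<open>F\<close> at
        \<open>u\<close> makes the two increments telescope to
        \<open>h (F v) (G v) - h (F u) (G u)\<close>, and each of them is the integral of a linear
        image of \<open>f\<close> or \<open>g\<close>.\<close>
      have p1: "primitive (\<lambda>t. h (f t) (G v)) (\<lambda>t. h (F t) (G v))"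
        by (rule primitive_linear[OF f bounded_linear_left])
      have p2: "primitive (\<lambda>t. h (F u) (g t)) (\<lambda>t. h (F u) (G t))"
        by (rule primitive_linear[OF g bounded_linear_right])
      let ?r = "\<lambda>t. h (f t) (G v) + h (F u) (g t) + (-1) *\<^sub>R q t"
      have p3: "primitive ?r (\<lambda>t. h (F t) (G v) + h (F u) (G t) + (-1) *\<^sub>R Q t)"
        by (intro primitive_add p1 p2 primitive_linear[OF Q bounded_linear_scaleR_right])
      have "h (F v) (G v) - Q v - (h (F u) (G u) - Q u) = integral {u..v} ?r"
        using primitive_diff[OF p3 \<open>u \<le> v\<close>] by (simp add: algebra_simps)
      also have "norm \<dots> \<le> integral {u..v} (\<lambda>t. e * (norm (f t) + norm (g t)))"
      proof (rule integral_norm_bound_integral)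
        show "?r integrable_on {u..v}" by (rule primitive_integrable[OF p3])
        show "(\<lambda>t. e * (norm (f t) + norm (g t))) integrable_on {u..v}"
          using primitive_integrable[OF m] by (rule integrable_on_mult_right)
        fix t
        assume t: "t \<in> {u..v}"
        have "?r t = h (f t) (G v - G t) + h (F u - F t) (g t)"
          by (simp add: q_def diff_left diff_right)
        also have "norm \<dots> \<le> norm (f t) * norm (G v - G t) * K + norm (F u - F t) * norm (g t) * K"
          by (intro order.trans[OF norm_triangle_ineq] add_mono K(2))
        also have "\<dots> \<le> norm (f t) * (e / K) * K + (e / K) * norm (g t) * K"
          using t K(1) \<open>u \<le> v\<close>
          by (intro add_mono mult_right_mono mult_left_mono F G) auto
        also have "\<dots> = e * (norm (f t) + norm (g t))"
          using K(1) by (simp add: field_simps)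
        finally show "norm (?r t) \<le> e * (norm (f t) + norm (g t))" .
      qed
      also have "\<dots> = e * (m v - m u)"
        using primitive_diff[OF m \<open>u \<le> v\<close>] by simp
      finally show "norm (h (F v) (G v) - Q v - (h (F u) (G u) - Q u)) \<le> e * (m v - m u)" .
    qed
  qed
  then have "h (F b) (G b) - h (F a) (G a) = Q b - Q a" if "a \<le> b" for a b
    using that by (simp add: algebra_simps)
  then show ?thesis
    using Q unfolding q_def primitive_def by simp
qed

text \<open>The mean value theorem for \<open>\<phi>\<close> writes an increment as the integral of
  \<open>\<phi>' \<xi> * f t\<close> with a fixed \<open>\<xi>\<close>. Continuity of
  \<open>\<phi>'\<close> brings this close to the expected density, with error controlled by a
  primitive of \<open>norm (f t)\<close>.\<close>

lemma primitive_chain: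
  fixes f m :: "real \<Rightarrow> real"
  assumes f: "primitive f m" and \<phi>: "\<And>x. (\<phi> has_real_derivative \<phi>' x) (at x)"
    and \<phi>': "continuous_on UNIV \<phi>'"
  shows "primitive (\<lambda>t. \<phi>' (m t) * f t) (\<lambda>t. \<phi> (m t))"
proof -
  define q where "q t = \<phi>' (m t) * f t" for t
  have cont: "continuous_on A (\<lambda>t. \<phi>' (m t))" for A
    using continuous_on_compose2[OF \<phi>' primitive_continuous_on[OF f]] by auto
  have q: "q absolutely_integrable_on {a..b}" for a b
    unfolding q_def
    by (rule absolutely_integrable_continuous_bilinear[OF bounded_bilinear_mult cont
          primitive_absolutely_integrable[OF f]])
  obtain Q where Q: "primitive q Q"
    using primitive_exists q by blast
  have n: "(\<lambda>t. norm (f t)) absolutely_integrable_on {a..b}" for a b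
    using absolutely_integrable_norm[OF primitive_absolutely_integrable[OF f]] by (simp add: o_def)
  obtain M where M: "primitive (\<lambda>t. norm (f t)) M"
    using primitive_exists n by blast
  have "\<phi> (m b) - Q b = \<phi> (m a) - Q a" if "a \<le> b" for a b
  proof (rule constant_if_increments_negligible[OF that, where m = M])
    fix x e :: real
    assume "e > 0"
    have "isCont \<phi>' (m x)"
      using \<phi>' by (simp add: continuous_on_eq_continuous_at)
    then obtain d1 where d1: "d1 > 0" "\<And>y. dist y (m x) < d1 \<Longrightarrow> dist (\<phi>' y) (\<phi>' (m x)) < e/2"
      using half_gt_zero[OF \<open>e > 0\<close>] unfolding continuous_at_eps_delta by blast
    obtain d where d: "d > 0" "\<And>y. dist y x < d \<Longrightarrow> dist (m y) (m x) < d1"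
      using primitive_isCont[OF f, of x] d1 unfolding continuous_at_eps_delta by blast
    show "\<exists>d>0. \<forall>u v. u \<le> x \<and> x \<le> v \<and> v - u < d \<longrightarrow>
        norm (\<phi> (m v) - Q v - (\<phi> (m u) - Q u)) \<le> e * (M v - M u)"
    proof (intro exI[of _ d] conjI allI impI; (elim conjE)?)
      show "d > 0" by fact
      fix u v :: real
      assume uv: "u \<le> x" "x \<le> v" "v - u < d"
      have m: "dist (m y) (m x) < d1" if "y \<in> {u..v}" for y
        using that uv by (intro d(2)) (auto simp: dist_real_def)
      have "u \<le> v" using uv by simp
      \<comment> \<open>The values \<open>m u\<close> and \<open>m v\<close> may come in either
        order or coincide. In every case \<open>\<xi>\<close> can be taken in the
        \<open>d1\<close>-neighbourhood of \<open>m x\<close>, because both values lie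
        there.\<close>
      obtain \<xi> where \<xi>: "dist \<xi> (m x) < d1" "\<phi> (m v) - \<phi> (m u) = \<phi>' \<xi> * (m v - m u)"
      proof (cases "m u" "m v" rule: linorder_cases)
        case less
        then obtain z where "m u < z" "z < m v" "\<phi> (m v) - \<phi> (m u) = (m v - m u) * \<phi>' z"
          using MVT2[of "m u" "m v" \<phi> \<phi>'] \<phi> by blast
        then show ?thesis
          using m[of u] m[of v] \<open>u \<le> v\<close> by (intro that[of z]) (auto simp: dist_real_def)
      next
        case equal
        then show ?thesis
          using d1 by (intro that[of "m x"]) auto
      next
        case greater
        then obtain z where "m v < z" "z < m u" "\<phi> (m u) - \<phi> (m v) = (m u - m v) * \<phi>' z"
          using MVT2[of "m v" "m u" \<phi> \<phi>'] \<phi> by blast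
        then show ?thesis
          using m[of u] m[of v] \<open>u \<le> v\<close> by (intro that[of z]) (auto simp: dist_real_def algebra_simps)
      qed
      let ?r = "\<lambda>t. \<phi>' \<xi> * f t + (-1) * q t"
      have p: "primitive ?r (\<lambda>t. \<phi>' \<xi> * m t + (-1) * Q t)"
        by (intro primitive_add primitive_linear[OF Q bounded_linear_mult_right]
            primitive_linear[OF f bounded_linear_mult_right])
      have "\<phi> (m v) - Q v - (\<phi> (m u) - Q u) = integral {u..v} ?r"
        using primitive_diff[OF p \<open>u \<le> v\<close>] \<xi>(2) by (simp add: algebra_simps)
      also have "norm \<dots> \<le> integral {u..v} (\<lambda>t. e * norm (f t))"
      proof (rule integral_norm_bound_integral)
        show "?r integrable_on {u..v}" by (rule primitive_integrable[OF p])
        show "(\<lambda>t. e * norm (f t)) integrable_on {u..v}"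
          using primitive_integrable[OF M] by (rule integrable_on_mult_right)
        fix t
        assume t: "t \<in> {u..v}"
        have "dist (\<phi>' \<xi>) (\<phi>' (m x)) < e/2" "dist (\<phi>' (m t)) (\<phi>' (m x)) < e/2"
          using d1(2) \<xi>(1) m[OF t] by auto
        then have "\<bar>\<phi>' \<xi> - \<phi>' (m t)\<bar> \<le> e"
          unfolding dist_real_def by linarith
        then have "\<bar>\<phi>' \<xi> - \<phi>' (m t)\<bar> * \<bar>f t\<bar> \<le> e * \<bar>f t\<bar>"
          by (rule mult_right_mono) simp
        then show "norm (?r t) \<le> e * norm (f t)"
          by (simp add: q_def abs_mult[symmetric] left_diff_distrib)
      qed
      also have "\<dots> = e * (M v - M u)"
        using primitive_diff[OF M \<open>u \<le> v\<close>] by simp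
      finally show "norm (\<phi> (m v) - Q v - (\<phi> (m u) - Q u)) \<le> e * (M v - M u)" .
    qed
  qed
  then have "\<phi> (m b) - \<phi> (m a) = Q b - Q a" if "a \<le> b" for a b
    using that by (simp add: algebra_simps)
  then show ?thesis
    using Q unfolding q_def primitive_def by simp
qed


section \<open>Existence and uniqueness of Caratheodory solutions\<close>

lemma bounded_bilinear_matrix_mult:
  "bounded_bilinear ((**) :: real^'n^'m \<Rightarrow> real^'p^'n \<Rightarrow> real^'p^'m)"
  unfolding bilinear_conv_bounded_bilinear[symmetric] bilinear_def
  by (auto intro!: linearI simp: matrix_matrix_mult_def vec_eq_iff sum_distrib_left
      distrib_left distrib_right sum.distrib mult_ac)

lemma primitive_mult_continuous:
  assumes "locally_integrable B" "\<And>A. continuous_on A Z"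
  shows "\<exists>J. primitive (\<lambda>t. B t ** Z t) J"
proof (rule primitive_exists)
  show "(\<lambda>t. B t ** Z t) absolutely_integrable_on {a..b}" for a b
    using assms
    by (intro absolutely_integrable_bilinear_continuous[OF bounded_bilinear_matrix_mult])
       (auto simp: locally_integrable_def)
qed

text \<open>Bounding the product instead of \<open>B t\<close> alone absorbs the constant of matrix
  multiplication in the entrywise norm into \<open>\<beta>\<close>. Testing with
  \<open>mat 1\<close> shows \<open>\<beta>\<close> to be nonnegative, so \<open>m\<close> is a
  nondecreasing clock.\<close>

definition majorant :: "'n::finite coeff \<Rightarrow> (real \<Rightarrow> real) \<Rightarrow> (real \<Rightarrow> real) \<Rightarrow> bool" where
  "majorant B \<beta> m \<longleftrightarrow>
     primitive \<beta> m \<and> (\<forall>t (Z::real^'n^'n). norm (B t ** Z) \<le> \<beta> t * norm Z)"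

lemma majorant_exists:
  fixes B :: "'n::finite coeff"
  assumes "locally_integrable B"
  shows "\<exists>\<beta> m. majorant B \<beta> m"
proof -
  obtain K where K: "K > 0" "\<And>(x::real^'n^'n) (y::real^'n^'n). norm (x ** y) \<le> norm x * norm y * K"
    using bounded_bilinear.pos_bounded[OF bounded_bilinear_matrix_mult] by blast
  have "(\<lambda>t. norm (B t) * K) absolutely_integrable_on {a..b}" for a b
    using assms absolutely_integrable_norm[where f = B and S = "{a..b}"]
    by (auto simp: locally_integrable_def o_def intro!: set_integrable_mult_left)
  then obtain m where "primitive (\<lambda>t. norm (B t) * K) m"
    using primitive_exists by blast
  moreover have "norm (B t ** Z) \<le> norm (B t) * K * norm Z" for t and Z :: "real^'n^'n"
    using K(2)[of "B t" Z] by (simp add: mult_ac)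
  ultimately show ?thesis
    unfolding majorant_def by blast
qed

text \<open>In the weighted norm with weight \<open>exp (2 * \<bar>m t - m s\<bar>)\<close> the Volterra operator of the
  linear equation is a contraction with constant \<open>1/2\<close> on every interval. Existence and
  uniqueness both rest on this estimate.\<close>

lemma volterra_contraction:
  fixes B Z J :: "'n::finite coeff" and m :: "real \<Rightarrow> real"
  assumes maj: "majorant B \<beta> m" and J: "primitive (\<lambda>t. B t ** Z t) J" and "C \<ge> 0"
    and Z: "\<And>\<tau>. \<tau> \<in> closed_segment s t \<Longrightarrow> norm (Z \<tau>) \<le> C * exp (2 * \<bar>m \<tau> - m s\<bar>)"
  shows "norm (J t - J s) \<le> C / 2 * exp (2 * \<bar>m t - m s\<bar>)"
proof -
  have m: "primitive \<beta> m" and \<beta>: "norm (B \<tau> ** A) \<le> \<beta> \<tau> * norm A" for \<tau> and A :: "real^'n^'n"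
    using maj by (auto simp: majorant_def)
  have \<beta>0: "\<beta> \<tau> \<ge> 0" for \<tau>
  proof -
    have "0 \<le> \<beta> \<tau> * norm (mat 1 :: real^'n^'n)"
      using \<beta>[of \<tau> "mat 1"] norm_ge_zero order.trans by blast
    moreover have "norm (mat 1 :: real^'n^'n) > 0"
      by (simp add: mat_def vec_eq_iff)
    ultimately show ?thesis by (simp add: zero_le_mult_iff)
  qed
  have mono: "m u \<le> m v" if "u \<le> v" for u v
    using primitive_diff[OF m that] integral_nonneg[OF primitive_integrable[OF m]] \<beta>0
    by (metis diff_ge_0_iff_ge)
  show ?thesis
  proof (cases "s \<le> t")
    case True
    have p: "primitive (\<lambda>\<tau>. C * exp (2 * (m \<tau> - m s)) * \<beta> \<tau>) (\<lambda>\<tau>. C / 2 * exp (2 * (m \<tau> - m s)))"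
      by (rule primitive_chain[OF m, where \<phi> = "\<lambda>x. C / 2 * exp (2 * (x - m s))" and \<phi>' = "\<lambda>x. C * exp (2 * (x - m s))"])
         (auto intro!: derivative_eq_intros continuous_intros)
    have "norm (J t - J s) = norm (integral {s..t} (\<lambda>\<tau>. B \<tau> ** Z \<tau>))"
      using primitive_diff[OF J True] by simp
    also have "\<dots> \<le> integral {s..t} (\<lambda>\<tau>. C * exp (2 * (m \<tau> - m s)) * \<beta> \<tau>)"
    proof (rule integral_norm_bound_integral[OF primitive_integrable[OF J] primitive_integrable[OF p]])
      fix \<tau>
      assume \<tau>: "\<tau> \<in> {s..t}"
      have "norm (B \<tau> ** Z \<tau>) \<le> \<beta> \<tau> * norm (Z \<tau>)" by (rule \<beta>)
      also have "\<dots> \<le> \<beta> \<tau> * (C * exp (2 * \<bar>m \<tau> - m s\<bar>))"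
        using \<tau> by (intro mult_left_mono Z \<beta>0) (auto simp: closed_segment_eq_real_ivl)
      finally show "norm (B \<tau> ** Z \<tau>) \<le> C * exp (2 * (m \<tau> - m s)) * \<beta> \<tau>"
        using mono[of s \<tau>] \<tau> by (simp add: mult_ac)
    qed
    also have "\<dots> = C / 2 * exp (2 * (m t - m s)) - C / 2"
      using primitive_diff[OF p True] by simp
    finally show ?thesis
      using mono[OF True] \<open>C \<ge> 0\<close> by simp
  next
    case False
    then have ts: "t \<le> s" by simp
    \<comment> \<open>To the left of \<open>s\<close> the absolute value opens with the other sign,
      so the primitive carries a minus sign.\<close>
    have p: "primitive (\<lambda>\<tau>. C * exp (2 * (m s - m \<tau>)) * \<beta> \<tau>) (\<lambda>\<tau>. - C / 2 * exp (2 * (m s - m \<tau>)))"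
      by (rule primitive_chain[OF m, where \<phi> = "\<lambda>x. - C / 2 * exp (2 * (m s - x))" and \<phi>' = "\<lambda>x. C * exp (2 * (m s - x))"])
         (auto intro!: derivative_eq_intros continuous_intros)
    have "norm (J t - J s) = norm (integral {t..s} (\<lambda>\<tau>. B \<tau> ** Z \<tau>))"
      using primitive_diff[OF J ts] by (simp add: norm_minus_commute)
    also have "\<dots> \<le> integral {t..s} (\<lambda>\<tau>. C * exp (2 * (m s - m \<tau>)) * \<beta> \<tau>)"
    proof (rule integral_norm_bound_integral[OF primitive_integrable[OF J] primitive_integrable[OF p]])
      fix \<tau>
      assume \<tau>: "\<tau> \<in> {t..s}"
      have "norm (B \<tau> ** Z \<tau>) \<le> \<beta> \<tau> * norm (Z \<tau>)" by (rule \<beta>)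
      also have "\<dots> \<le> \<beta> \<tau> * (C * exp (2 * \<bar>m \<tau> - m s\<bar>))"
        using \<tau> by (intro mult_left_mono Z \<beta>0) (auto simp: closed_segment_eq_real_ivl)
      finally show "norm (B \<tau> ** Z \<tau>) \<le> C * exp (2 * (m s - m \<tau>)) * \<beta> \<tau>"
        using mono[of \<tau> s] \<tau> by (simp add: mult_ac)
    qed
    also have "\<dots> = C / 2 * exp (2 * (m s - m t)) - C / 2"
      using primitive_diff[OF p ts] by simp
    finally show ?thesis
      using mono[OF ts] \<open>C \<ge> 0\<close> by simp
  qed
qed

text \<open>A solution vanishing at \<open>s\<close> is a fixed point of the Volterra operator.
  Every application of the contraction estimate halves its bound on the segment from
  \<open>s\<close> to \<open>t\<close>, so the bound tends to 0.\<close>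

lemma linear_equation_unique:
  fixes B Z :: "'n::finite coeff"
  assumes B: "locally_integrable B" and Z: "primitive (\<lambda>t. B t ** Z t) Z" and "Z s = 0"
  shows "Z t = 0"
proof -
  obtain \<beta> m where m: "majorant B \<beta> m"
    using majorant_exists[OF B] by blast
  have "bounded (Z ` closed_segment s t)"
    by (intro compact_imp_bounded compact_continuous_image primitive_continuous_on[OF Z]) auto
  then obtain C where C: "\<And>\<tau>. \<tau> \<in> closed_segment s t \<Longrightarrow> norm (Z \<tau>) \<le> C"
    unfolding bounded_iff by blast
  have "C \<ge> 0"
    using C[of s] norm_ge_zero[of "Z s"] by (simp del: norm_ge_zero)
  have bound: "norm (Z \<tau>) \<le> C / 2 ^ n * exp (2 * \<bar>m \<tau> - m s\<bar>)" if "\<tau> \<in> closed_segment s t" for n \<tau>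
    using that
  proof (induction n arbitrary: \<tau>)
    case 0
    have "C * 1 \<le> C * exp (2 * \<bar>m \<tau> - m s\<bar>)"
      using \<open>C \<ge> 0\<close> by (intro mult_left_mono) auto
    then show ?case
      using C[OF 0] by simp
  next
    case (Suc n)
    have "closed_segment s \<tau> \<subseteq> closed_segment s t"
      using Suc.prems by (simp add: subset_closed_segment)
    then have "norm (Z \<tau> - Z s) \<le> C / 2 ^ n / 2 * exp (2 * \<bar>m \<tau> - m s\<bar>)"
      using \<open>C \<ge> 0\<close> by (intro volterra_contraction[OF m Z] Suc.IH) auto
    then show ?case
      using \<open>Z s = 0\<close> by (simp add: field_simps)
  qed
  have "(\<lambda>n. C * exp (2 * \<bar>m t - m s\<bar>) * (1/2) ^ n) \<longlonglongrightarrow> C * exp (2 * \<bar>m t - m s\<bar>) * 0"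
    by (intro tendsto_mult tendsto_const LIMSEQ_power_zero) simp
  moreover have "norm (Z t) \<le> C * exp (2 * \<bar>m t - m s\<bar>) * (1/2) ^ n" for n
    using bound[of t n] by (simp add: power_divide mult_ac)
  ultimately have "norm (Z t) \<le> C * exp (2 * \<bar>m t - m s\<bar>) * 0"
    using LIMSEQ_le_const by blast
  then show ?thesis by simp
qed

lemma fundamental_solution_iff:
  "is_fundamental_solution B s X \<longleftrightarrow> X s = mat 1 \<and> primitive (\<lambda>t. B t ** X t) X"
  by (simp add: is_fundamental_solution_def primitive_def)

text \<open>The solution is the Neumann series of the Volterra operator applied to the identity
  matrix. Its terms decay geometrically in the weighted norm, so the sum is continuous, and the
  recursion for the partial sums passes to the limit as the integral equation.\<close>

lemma fundamental_solution_exists: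
  fixes B :: "'n::finite coeff"
  assumes B: "locally_integrable B"
  shows "\<exists>X. is_fundamental_solution B s X"
proof -
  obtain \<beta> m where m: "majorant B \<beta> m"
    using majorant_exists[OF B] by blast
  define E where "E t = exp (2 * \<bar>m t - m s\<bar>)" for t
  have E1: "E t \<ge> 1" for t by (simp add: E_def)
  \<comment> \<open>A primitive is determined only up to a constant; \<open>J\<close> is used
    through differences of its values, so the choice does not matter.\<close>
  define J where "J F = (SOME G. primitive (\<lambda>t. B t ** F t) G)" for F :: "'n coeff"
  have J: "primitive (\<lambda>t. B t ** F t) (J F)" if "\<And>A. continuous_on A F" for F
    unfolding J_def by (rule someI_ex[OF primitive_mult_continuous[OF B that]])
  define Y where "Y n = ((\<lambda>F t. J F t - J F s) ^^ n) (\<lambda>_. mat 1)" for n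
  have Y0: "Y 0 = (\<lambda>_. mat 1)" and YS: "Y (Suc n) = (\<lambda>t. J (Y n) t - J (Y n) s)" for n
    by (simp_all add: Y_def)
  define C where "C = norm (mat 1 :: real^'n^'n)"
  have C0: "C \<ge> 0" by (simp add: C_def)
  have Yc: "continuous_on A (Y n)" for A n
  proof (induction n arbitrary: A)
    case (Suc n)
    then show ?case
      unfolding YS by (intro continuous_intros primitive_continuous_on[OF J])
  qed (simp add: Y0)
  have JY: "primitive (\<lambda>t. B t ** Y n t) (J (Y n))" for n
    by (intro J Yc)
  have Yb: "norm (Y n t) \<le> C / 2 ^ n * E t" for n t
  proof (induction n arbitrary: t)
    case 0
    show ?case
      using mult_left_mono[OF E1 C0] by (simp add: Y0 C_def)
  next
    case (Suc n)
    have "norm (J (Y n) t - J (Y n) s) \<le> C / 2 ^ n / 2 * exp (2 * \<bar>m t - m s\<bar>)"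
      using C0 Suc.IH by (intro volterra_contraction[OF m JY]) (auto simp: E_def)
    then show ?case
      by (simp add: YS E_def field_simps)
  qed
  define S where "S n t = (\<Sum>k<n. Y k t)" for n t
  define X where "X t = (\<Sum>k. Y k t)" for t
  have sm: "summable (\<lambda>k. C / 2 ^ (k + n) * E t)" for n t
  proof -
    have "summable (\<lambda>k. (C / 2 ^ n * E t) * (1/2) ^ k)"
      by (intro summable_mult summable_geometric) simp
    then show ?thesis by (simp add: power_add power_divide mult_ac)
  qed
  \<comment> \<open>The factor 2 is the sum of the geometric series with ratio
    \<open>1/2\<close>.\<close>
  have tail: "norm (X t - S n t) \<le> 2 * C / 2 ^ n * E t" for n t
  proof -
    have sY: "summable (\<lambda>k. Y k t)"
    proof (rule summable_comparison_test'[where g = "\<lambda>k. C / 2 ^ k * E t" and N = 0])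
      show "summable (\<lambda>k. C / 2 ^ k * E t)" using sm[of 0 t] by simp
      show "norm (Y k t) \<le> C / 2 ^ k * E t" for k by (rule Yb)
    qed
    have "X t - S n t = (\<Sum>k. Y (k + n) t)"
      unfolding X_def S_def using suminf_minus_initial_segment[OF sY, of n] by simp
    also have "norm \<dots> \<le> (\<Sum>k. C / 2 ^ (k + n) * E t)"
    proof (rule norm_suminf_le)
      show "norm (Y (k + n) t) \<le> C / 2 ^ (k + n) * E t" for k by (rule Yb)
      show "summable (\<lambda>k. C / 2 ^ (k + n) * E t)" by (rule sm)
    qed
    also have "\<dots> = (\<Sum>k. (C / 2 ^ n * E t) * (1/2) ^ k)"
      by (simp add: power_add power_divide mult_ac)
    also have "\<dots> = 2 * C / 2 ^ n * E t"
      by (subst suminf_mult) (simp_all add: suminf_geometric summable_geometric)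
    finally show ?thesis .
  qed
  have lim0: "(\<lambda>n. c / 2 ^ n) \<longlonglongrightarrow> 0" for c :: real
    using tendsto_mult[OF tendsto_const[of c] LIMSEQ_power_zero[of "1/2::real"]]
    by (simp add: power_divide)
  have Sc: "continuous_on A (S n)" for A n
    unfolding S_def by (intro continuous_intros Yc)
  have "isCont X t" for t
  proof -
    have "continuous_on {t-1..t+1} m"
      using m primitive_continuous_on unfolding majorant_def by blast
    then have "continuous_on {t-1..t+1} E"
      unfolding E_def by (intro continuous_intros)
    then have "bounded (E ` {t-1..t+1})"
      by (intro compact_imp_bounded compact_continuous_image) auto
    then obtain D where D: "\<And>\<tau>. \<tau> \<in> {t-1..t+1} \<Longrightarrow> norm (E \<tau>) \<le> D"
      unfolding bounded_iff by blast
    \<comment> \<open>The tail bound contains the weight \<open>E\<close>; since \<open>E\<close> is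
      bounded on this compact interval, convergence there is uniform.\<close>
    have "uniform_limit {t-1..t+1} S X sequentially"
    proof (rule uniform_limitI)
      fix e :: real
      assume "e > 0"
      then have "\<forall>\<^sub>F n in sequentially. 2 * C * D / 2 ^ n < e"
        using order_tendstoD(2)[OF lim0[of "2 * C * D"], of e] by simp
      then show "\<forall>\<^sub>F n in sequentially. \<forall>\<tau>\<in>{t-1..t+1}. dist (S n \<tau>) (X \<tau>) < e"
      proof (eventually_elim, intro ballI)
        fix n \<tau>
        assume n: "2 * C * D / 2 ^ n < e" and \<tau>: "\<tau> \<in> {t-1..t+1}"
        have "dist (S n \<tau>) (X \<tau>) \<le> 2 * C / 2 ^ n * E \<tau>"
          using tail[of \<tau> n] by (simp add: dist_norm norm_minus_commute)
        also have "\<dots> \<le> 2 * C / 2 ^ n * D"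
          using D[OF \<tau>] C0 by (intro mult_left_mono) auto
        finally show "dist (S n \<tau>) (X \<tau>) < e" using n by simp
      qed
    qed
    then have "continuous_on {t-1..t+1} X"
      by (rule uniform_limit_theorem[rotated]) (simp_all add: Sc)
    then show ?thesis
      by (rule continuous_on_interior) auto
  qed
  then have Xc: "continuous_on A X" for A
    by (simp add: continuous_at_imp_continuous_on)
  have JX: "primitive (\<lambda>t. B t ** X t) (J X)"
    by (intro J Xc)
  interpret bounded_bilinear "(**) :: real^'n^'n \<Rightarrow> real^'n^'n \<Rightarrow> real^'n^'n"
    by (rule bounded_bilinear_matrix_mult)
  have JS: "primitive (\<lambda>t. B t ** S n t) (\<lambda>t. \<Sum>k<n. J (Y k) t)" for n
  proof (induction n)
    case 0
    then show ?case by (simp add: S_def zero_right primitive_def)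
  next
    case (Suc n)
    then show ?case
      using primitive_add[OF Suc JY[of n]] by (simp add: S_def add_right)
  qed
  \<comment> \<open>The Volterra operator sends \<open>Y k\<close> to \<open>Y (Suc k)\<close>, so
    applied to \<open>S n\<close> it yields all of \<open>S (Suc n)\<close> except the initial term
    \<open>mat 1\<close>.\<close>
  have SS: "S (Suc n) t = mat 1 + ((\<Sum>k<n. J (Y k) t) - (\<Sum>k<n. J (Y k) s))" for n t
    by (induction n) (simp_all add: S_def Y0 YS)
  have X: "X t = mat 1 + (J X t - J X s)" for t
  proof -
    have "norm (X t - (mat 1 + (J X t - J X s))) \<le> 2 * C * E t / 2 ^ n" for n
    proof -
      \<comment> \<open>\<open>?G\<close> is a primitive of \<open>B t ** (X t - S n t)\<close>. The
        contraction halves the tail bound of \<open>S n\<close>, matching the tail bound of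
        \<open>S (Suc n)\<close>; adding the two bounds the defect in the integral equation.\<close>
      let ?G = "\<lambda>t. J X t + (-1) *\<^sub>R (\<Sum>k<n. J (Y k) t)"
      have "primitive (\<lambda>t. B t ** (X t - S n t)) ?G"
        using primitive_add[OF JX primitive_linear[OF JS[of n] bounded_linear_scaleR_right, of "-1"]]
        by (simp add: diff_right)
      then have "norm (?G t - ?G s) \<le> (2 * C / 2 ^ n) / 2 * exp (2 * \<bar>m t - m s\<bar>)"
        using C0 tail by (intro volterra_contraction[OF m]) (auto simp: E_def)
      then have 1: "norm (?G t - ?G s) \<le> C * E t / 2 ^ n"
        by (simp add: E_def)
      have 2: "norm (X t - S (Suc n) t) \<le> C * E t / 2 ^ n"
        using tail[of t "Suc n"] by simp
      have eq: "X t - (mat 1 + (J X t - J X s)) = (X t - S (Suc n) t) - (?G t - ?G s)"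
        by (simp add: SS)
      have "norm (X t - (mat 1 + (J X t - J X s))) \<le> C * E t / 2 ^ n + C * E t / 2 ^ n"
        unfolding eq by (rule order.trans[OF norm_triangle_ineq4 add_mono[OF 2 1]])
      then show ?thesis by simp
    qed
    then have "norm (X t - (mat 1 + (J X t - J X s))) \<le> 0"
      by (intro LIMSEQ_le_const[OF lim0[of "2 * C * E t"]]) auto
    then show ?thesis by simp
  qed
  have "is_fundamental_solution B s X"
    unfolding fundamental_solution_iff
  proof
    show "X s = mat 1" by (simp add: X[of s])
    have "X b - X a = J X b - J X a" for a b
      by (simp add: X[of a] X[of b])
    then show "primitive (\<lambda>t. B t ** X t) X"
      using JX by (simp add: primitive_def)
  qed
  then show ?thesis by blast
qed


lemma fundamental_solution_unique:
  fixes B X Y :: "'n::finite coeff"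
  assumes B: "locally_integrable B"
    and X: "is_fundamental_solution B s X" and Y: "is_fundamental_solution B s Y"
  shows "X = Y"
proof
  fix t
  interpret bounded_bilinear "(**) :: real^'n^'n \<Rightarrow> real^'n^'n \<Rightarrow> real^'n^'n"
    by (rule bounded_bilinear_matrix_mult)
  have pX: "primitive (\<lambda>t. B t ** X t) X" and pY: "primitive (\<lambda>t. B t ** Y t) Y"
    using X Y by (simp_all add: fundamental_solution_iff)
  have "primitive (\<lambda>t. B t ** (X t - Y t)) (\<lambda>t. X t - Y t)"
    using primitive_add[OF pX primitive_linear[OF pY bounded_linear_scaleR_right, of "-1"]]
    by (simp add: diff_right)
  then have "X t - Y t = 0"
    by (rule linear_equation_unique[OF B, where Z = "\<lambda>t. X t - Y t" and s = s])
       (use X Y in \<open>simp add: fundamental_solution_iff\<close>)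
  then show "X t = Y t" by simp
qed

section \<open>The evolution operator\<close>

text \<open>Uniqueness resolves the description in \<open>evolution\<close>, so an evolution
  operator can be identified by exhibiting a fundamental solution.\<close>

lemma evolution_eqI:
  assumes "locally_integrable B" "is_fundamental_solution B s X"
  shows "evolution B t s = X t"
proof -
  have "(THE X. is_fundamental_solution B s X) = X"
    using assms(2) fundamental_solution_unique[OF assms(1) _ assms(2)] by (rule the_equality)
  then show ?thesis
    by (simp add: evolution_def)
qed

lemma evolution_fundamental:
  assumes "locally_integrable B"
  shows "is_fundamental_solution B s (\<lambda>t. evolution B t s)"
proof -
  obtain X where X: "is_fundamental_solution B s X"
    using fundamental_solution_exists[OF assms] by blast
  moreover have "(\<lambda>t. evolution B t s) = X"
    by (intro ext evolution_eqI[OF assms X])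
  ultimately show ?thesis by simp
qed

lemma evolution_refl: "locally_integrable B \<Longrightarrow> evolution B s s = mat 1"
  by (drule evolution_fundamental[where s = s]) (simp add: fundamental_solution_iff)

lemma primitive_evolution:
  "locally_integrable B \<Longrightarrow> primitive (\<lambda>t. B t ** evolution B t s) (\<lambda>t. evolution B t s)"
  by (drule evolution_fundamental[where s = s]) (simp add: fundamental_solution_iff)

text \<open>Right multiplication by a constant matrix preserves the equation. As functions of
  \<open>t\<close> both sides are solutions agreeing at \<open>s\<close>, so their difference
  vanishes.\<close>

lemma evolution_cocycle:
  fixes B :: "'n::finite coeff"
  assumes B: "locally_integrable B"
  shows "evolution B t s ** evolution B s r = evolution B t r"
proof -
  interpret bounded_bilinear "(**) :: real^'n^'n \<Rightarrow> real^'n^'n \<Rightarrow> real^'n^'n"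
    by (rule bounded_bilinear_matrix_mult)
  let ?C = "evolution B s r"
  let ?Z = "\<lambda>t. evolution B t s ** ?C - evolution B t r"
  have "primitive (\<lambda>t. B t ** evolution B t s ** ?C) (\<lambda>t. evolution B t s ** ?C)"
    by (rule primitive_linear[OF primitive_evolution[OF B, of s], where h = "\<lambda>A. A ** ?C"])
       (rule bounded_linear_left)
  then have p: "primitive (\<lambda>t. B t ** (evolution B t s ** ?C)) (\<lambda>t. evolution B t s ** ?C)"
    by (simp only: matrix_mul_assoc)
  have "primitive (\<lambda>t. B t ** ?Z t) ?Z"
    using primitive_add[OF p primitive_linear[OF primitive_evolution[OF B, of r]
          bounded_linear_scaleR_right, of "-1"]]
    by (simp add: diff_right)
  then have "?Z t = 0"
    by (rule linear_equation_unique[OF B, where Z = ?Z and s = s and t = t])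
       (simp add: evolution_refl[OF B])
  then show ?thesis by simp
qed

lemma evolution_translate:
  fixes B :: "'n::finite coeff"
  assumes B: "locally_integrable B" "locally_integrable (translate \<tau> B)"
  shows "evolution (translate \<tau> B) t s = evolution B (t + \<tau>) (s + \<tau>)"
proof (rule evolution_eqI[OF B(2)])
  show "is_fundamental_solution (translate \<tau> B) s (\<lambda>t. evolution B (t + \<tau>) (s + \<tau>))"
    using primitive_shift[OF primitive_evolution[OF B(1), of "s + \<tau>"], of \<tau>]
    by (simp add: fundamental_solution_iff evolution_refl[OF B(1)] translate_def)
qed

lemma Phi_eq_evolution: "Phi \<omega> = evolution \<omega>"
  by (simp add: Phi_def evalA_def translate_def)

section \<open>Growth rates and the shifted equation\<close>

lemma fast_imp_growth_rate: "fast_growth_rate \<mu> \<Longrightarrow> growth_rate \<mu>"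
  by (simp add: fast_growth_rate_def)

lemma growth_rate_pos: "growth_rate \<mu> \<Longrightarrow> \<mu> t > 0"
  by (simp add: growth_rate_def)

lemma growth_rate_has_derivative: "growth_rate \<mu> \<Longrightarrow> (\<mu> has_real_derivative deriv \<mu> t) (at t)"
  by (simp add: growth_rate_def DERIV_deriv_iff_real_differentiable)

text \<open>The derivative of \<open>\<mu>\<close> need not be continuous; its local Lebesgue integrability comes
  from its sign, since every derivative is gauge integrable.\<close>

lemma primitive_log_growth_rate:
  assumes \<mu>: "growth_rate \<mu>"
  shows "primitive (\<lambda>t. deriv \<mu> t / \<mu> t) (\<lambda>t. ln (\<mu> t))"
  unfolding primitive_def
proof (intro allI impI conjI)
  fix a b :: real
  assume "a \<le> b"
  have "((\<lambda>t. ln (\<mu> t)) has_real_derivative deriv \<mu> t / \<mu> t) (at t)" for t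
    using growth_rate_has_derivative[OF \<mu>, of t] growth_rate_pos[OF \<mu>, of t]
    by (auto intro!: derivative_eq_intros simp: field_simps)
  then have int: "((\<lambda>t. deriv \<mu> t / \<mu> t) has_integral ln (\<mu> b) - ln (\<mu> a)) {a..b}"
    using \<open>a \<le> b\<close>
    by (intro fundamental_theorem_of_calculus)
       (auto simp: has_real_derivative_iff_has_vector_derivative[symmetric] intro: has_field_derivative_at_within)
  have "deriv \<mu> t \<ge> 0" for t
  proof (rule mono_on_imp_deriv_nonneg[where A = UNIV])
    show "mono_on UNIV \<mu>"
      using \<mu> by (auto simp: growth_rate_def intro: strict_mono_mono)
  qed (auto intro: growth_rate_has_derivative[OF \<mu>])
  then show "(\<lambda>t. deriv \<mu> t / \<mu> t) absolutely_integrable_on {a..b}"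
    using int growth_rate_pos[OF \<mu>]
    by (intro nonnegative_absolutely_integrable_1) (auto simp: less_imp_le)
  show "ln (\<mu> b) - ln (\<mu> a) = integral {a..b} (\<lambda>t. deriv \<mu> t / \<mu> t)"
    using int by (simp add: integral_unique)
qed

text \<open>The scalar factor solves the equation with coefficient
  \<open>- \<gamma> * (deriv \<mu> t / \<mu> t)\<close> and commutes with all matrices, so the
  product rule adds this term to the coefficient \<open>\<eta> t\<close>.\<close>

lemma evolution_shifted:
  fixes \<eta> :: "'n::finite coeff"
  assumes \<mu>: "growth_rate \<mu>" and \<eta>: "locally_integrable \<eta>"
  shows "evolution (shifted \<mu> \<eta> \<gamma>) t s = (\<mu> t / \<mu> s) powr (- \<gamma>) *\<^sub>R evolution \<eta> t s"
proof (rule evolution_eqI)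
  interpret bounded_bilinear "(**) :: real^'n^'n \<Rightarrow> real^'n^'n \<Rightarrow> real^'n^'n"
    by (rule bounded_bilinear_matrix_mult)
  note ln_\<mu> = primitive_log_growth_rate[OF \<mu>]
  show "locally_integrable (shifted \<mu> \<eta> \<gamma>)"
    unfolding locally_integrable_def shifted_def
  proof (intro allI set_integral_diff(1))
    fix a b
    show "\<eta> absolutely_integrable_on {a..b}"
      using \<eta> by (simp add: locally_integrable_def)
    have "bounded_linear (\<lambda>x. (\<gamma> * x) *\<^sub>R (mat 1 :: real^'n^'n))"
      by (intro bounded_linear_scaleR_const bounded_linear_mult_right)
    then show "(\<lambda>t. (\<gamma> * (deriv \<mu> t / \<mu> t)) *\<^sub>R (mat 1 :: real^'n^'n)) absolutely_integrable_on {a..b}"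
      using primitive_absolutely_integrable[OF primitive_linear[OF ln_\<mu>]] by blast
  qed
  \<comment> \<open>Written as an exponential of \<open>ln (\<mu> t)\<close>, the factor is a smooth
    function of a known primitive, so the chain rule applies although \<open>deriv \<mu>\<close> may
    be discontinuous.\<close>
  define f where "f t = exp (- \<gamma> * (ln (\<mu> t) - ln (\<mu> s)))" for t
  have powr_f: "(\<mu> t / \<mu> s) powr (- \<gamma>) = f t" for t
    using growth_rate_pos[OF \<mu>] by (simp add: powr_def f_def ln_div less_imp_neq[symmetric])
  have "primitive (\<lambda>t. - \<gamma> * exp (- \<gamma> * (ln (\<mu> t) - ln (\<mu> s))) * (deriv \<mu> t / \<mu> t)) f"
    unfolding f_def
    by (rule primitive_chain[OF ln_\<mu>, where \<phi> = "\<lambda>x. exp (- \<gamma> * (x - ln (\<mu> s)))"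
          and \<phi>' = "\<lambda>x. - \<gamma> * exp (- \<gamma> * (x - ln (\<mu> s)))"])
       (auto intro!: derivative_eq_intros continuous_intros)
  then have pf: "primitive (\<lambda>t. - \<gamma> * f t * (deriv \<mu> t / \<mu> t)) f"
    by (simp only: f_def)
  have "shifted \<mu> \<eta> \<gamma> t ** (f t *\<^sub>R evolution \<eta> t s)
      = (- \<gamma> * f t * (deriv \<mu> t / \<mu> t)) *\<^sub>R evolution \<eta> t s + f t *\<^sub>R (\<eta> t ** evolution \<eta> t s)" for t
    by (simp add: shifted_def diff_left scaleR_left scaleR_right algebra_simps)
  then show "is_fundamental_solution (shifted \<mu> \<eta> \<gamma>) s (\<lambda>t. (\<mu> t / \<mu> s) powr (- \<gamma>) *\<^sub>R evolution \<eta> t s)"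
    using primitive_product[OF bounded_bilinear_scaleR pf primitive_evolution[OF \<eta>, of s]]
    unfolding powr_f fundamental_solution_iff by (simp add: evolution_refl[OF \<eta>] f_def)
qed

section \<open>The operator norm and bounded growth on the hull\<close>

lemma opnorm_nonneg: "opnorm A \<ge> 0"
  unfolding opnorm_def by (rule onorm_pos_le) simp

lemma opnorm_zero: "opnorm 0 = 0"
  by (simp add: opnorm_def onorm_zero)

lemma opnorm_eq_0: "opnorm A = 0 \<longleftrightarrow> A = 0"
proof -
  have "opnorm A = 0 \<longleftrightarrow> (\<forall>x. A *v x = 0)"
    unfolding opnorm_def by (rule onorm_eq_0) simp
  then show ?thesis
    by (auto simp: matrix_eq)
qed

lemma opnorm_mult: "opnorm (A ** B) \<le> opnorm A * opnorm B"
  using onorm_compose[of "(*v) A" "(*v) B"]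
  by (simp add: opnorm_def o_def matrix_vector_mul_assoc)

lemma opnorm_scaleR: "opnorm (c *\<^sub>R A) = \<bar>c\<bar> * opnorm A"
  using onorm_scaleR[of "(*v) A" c]
  by (simp add: opnorm_def scaleR_matrix_vector_assoc)

text \<open>For each vector \<open>x\<close> the condition
  \<open>norm (A *v x) \<le> c * norm x\<close> is closed in \<open>A\<close>, and the set is the
  intersection of these conditions.\<close>

lemma closed_opnorm_le:
  assumes "c \<ge> 0"
  shows "closed {A :: real^'n^'n::finite. opnorm A \<le> c}"
proof -
  have "opnorm A \<le> c \<longleftrightarrow> (\<forall>x. norm (A *v x) \<le> c * norm x)" for A :: "real^'n^'n"
  proof
    assume "opnorm A \<le> c"
    then show "\<forall>x. norm (A *v x) \<le> c * norm x"
      unfolding opnorm_def using onorm[of "(*v) A"]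
      by (meson matrix_vector_mul_bounded_linear mult_right_mono norm_ge_zero order.trans)
  next
    assume "\<forall>x. norm (A *v x) \<le> c * norm x"
    then show "opnorm A \<le> c"
      unfolding opnorm_def by (intro onorm_bound assms) auto
  qed
  moreover have "linear (\<lambda>A :: real^'n^'n. A *v x)" for x
    by (intro linearI) (simp_all add: matrix_vector_mult_add_rdistrib scaleR_matrix_vector_assoc)
  then have "continuous_on UNIV (\<lambda>A :: real^'n^'n. A *v x)" for x
    using linear_continuous_on linear_conv_bounded_linear by blast
  ultimately show ?thesis
    by (auto intro!: closed_Collect_all closed_Collect_le continuous_intros)
qed

lemma translate_in_topspace:
  assumes "base_space \<Omega>" "\<omega> \<in> topspace \<Omega>"
  shows "translate \<tau> \<omega> \<in> topspace \<Omega>"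
  using assms continuous_map_image_subset_topspace[of "prod_topology euclideanreal \<Omega>" \<Omega> "\<lambda>(\<tau>, \<omega>). translate \<tau> \<omega>"]
  by (force simp: base_space_def)

lemma bounded_growth_hull:
  fixes \<Omega> :: "('n::finite coeff) topology"
  assumes \<Omega>: "base_space \<Omega>" and \<omega>: "\<omega> \<in> topspace \<Omega>" and \<eta>: "\<eta> \<in> orbit_hull \<Omega> \<omega>" and "L \<ge> 0"
    and growth: "\<And>t s. opnorm (Phi \<omega> t s) \<le> L * exp (a * \<bar>t - s\<bar>)"
  shows "opnorm (Phi \<eta> t s) \<le> L * exp (a * \<bar>t - s\<bar>)"
proof -
  let ?S = "{\<zeta> \<in> topspace \<Omega>. Phi \<zeta> t s \<in> {A. opnorm A \<le> L * exp (a * \<bar>t - s\<bar>)}}"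
  have li: "locally_integrable \<zeta>" if "\<zeta> \<in> topspace \<Omega>" for \<zeta>
    using \<Omega> that by (simp add: base_space_def)
  have joint: "continuous_map (prod_topology \<Omega> (prod_topology euclideanreal euclideanreal)) euclidean
      (\<lambda>(\<omega>, t, s). Phi \<omega> t s)"
    using \<Omega> by (simp add: base_space_def)
  have closed: "closed {A :: real^'n^'n. opnorm A \<le> L * exp (a * \<bar>t - s\<bar>)}"
    by (rule closed_opnorm_le) (simp add: \<open>L \<ge> 0\<close>)
  have "continuous_map \<Omega> (prod_topology \<Omega> (prod_topology euclideanreal euclideanreal)) (\<lambda>\<zeta>. (\<zeta>, t, s))"
    by (simp add: continuous_map_pairwise o_def)
  from continuous_map_compose[OF this joint]
  have "continuous_map \<Omega> euclidean (\<lambda>\<zeta>. Phi \<zeta> t s)"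
    by (simp add: o_def)
  then have "closedin \<Omega> ?S"
    by (rule closedin_continuous_map_preimage) (simp add: closed)
  \<comment> \<open>Translation moves both times by \<open>\<tau>\<close>, and the bound depends
    only on their difference.\<close>
  moreover have "translate \<tau> \<omega> \<in> ?S" for \<tau>
    using translate_in_topspace[OF \<Omega> \<omega>, of \<tau>] growth[of "t + \<tau>" "s + \<tau>"]
      evolution_translate[OF li[OF \<omega>] li[OF translate_in_topspace[OF \<Omega> \<omega>]]]
    by (simp add: Phi_eq_evolution)
  ultimately have "orbit_hull \<Omega> \<omega> \<subseteq> ?S"
    unfolding orbit_hull_def by (intro closure_of_minimal) auto
  then show ?thesis
    using \<eta> by blast
qed

section \<open>Exponentials against fast growth rates\<close>

text \<open>Writing \<open>z powr r\<close> as \<open>z * z powr (r - 1)\<close>, the second factor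
  is monotone and can be enlarged to its value at \<open>x + y\<close>.\<close>

lemma powr_superadditive:
  fixes x y r :: real
  assumes "x \<ge> 0" "y \<ge> 0" "r \<ge> 1"
  shows "x powr r + y powr r \<le> (x + y) powr r"
proof -
  have split: "z powr r = z * z powr (r - 1)" if "z \<ge> 0" for z :: real
    using that by (cases "z = 0") (simp_all add: powr_diff)
  have "x * x powr (r - 1) + y * y powr (r - 1) \<le> x * (x + y) powr (r - 1) + y * (x + y) powr (r - 1)"
    using assms by (intro add_mono mult_left_mono powr_mono2) auto
  then show ?thesis
    using assms by (simp add: split distrib_right)
qed

text \<open>For times on the same side of 0 superadditivity applies. If 0 separates them, the larger
  of \<open>t\<close> and \<open>- s\<close> is at least half the length of the interval, which is
  where the factor \<open>1/2\<close> comes from.\<close>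

lemma signed_powr_increment:
  fixes s t r :: real
  assumes "s \<le> t" "r \<ge> 1"
  shows "sgn t * \<bar>t\<bar> powr r - sgn s * \<bar>s\<bar> powr r \<ge> ((t - s) / 2) powr r"
proof -
  have half: "((t - s) / 2) powr r \<le> (t - s) powr r"
    using assms by (intro powr_mono2) auto
  consider "0 \<le> s" | "s < 0" "0 \<le> t" | "t < 0" by linarith
  then show ?thesis
  proof cases
    case 1
    have "(t - s) powr r + s powr r \<le> t powr r"
      using powr_superadditive[of "t - s" s r] assms 1 by simp
    then show ?thesis
      using half 1 assms by (auto simp: sgn_if)
  next
    case 2
    have "((t - s) / 2) powr r \<le> max t (- s) powr r"
      using 2 assms by (intro powr_mono2) auto
    also have "\<dots> \<le> t powr r + (- s) powr r"
      by (auto simp: max_def)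
    finally show ?thesis
      using 2 by (auto simp: sgn_if)
  next
    case 3
    have "(t - s) powr r + (- t) powr r \<le> (- s) powr r"
      using powr_superadditive[of "t - s" "- t" r] assms 3 by simp
    then show ?thesis
      using half 3 assms by (auto simp: sgn_if)
  qed
qed

text \<open>The exponent of the comparison rate grows at least like the power \<open>r > 1\<close>
  of half the interval length, so it beats the linear exponent on long intervals; short intervals
  only cost a constant.\<close>

lemma exp_dominated_by_fast_rate:
  assumes \<mu>: "fast_growth_rate \<mu>" and "a \<ge> 0" "c > 0"
  shows "\<exists>C\<ge>1. \<forall>t s. s \<le> t \<longrightarrow> exp (a * (t - s)) \<le> C * (\<mu> t / \<mu> s) powr c"
proof -
  obtain r M where r: "r > 1" and M: "M \<ge> 1"
    and fast: "\<And>t s. s \<le> t \<Longrightarrow> s_rate r t / s_rate r s \<le> M * (\<mu> t / \<mu> s)"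
    using \<mu> unfolding fast_growth_rate_def by blast
  have pos: "\<mu> t > 0" for t
    by (rule growth_rate_pos[OF fast_imp_growth_rate[OF \<mu>]])
  \<comment> \<open>When \<open>a > 0\<close>, \<open>R\<close> is the half-length at which
    \<open>c * R powr r\<close> equals \<open>2 * a * R\<close>. Beyond it \<open>c * g\<close>
    dominates \<open>a * (t - s)\<close>; below it \<open>a * (t - s)\<close> is at most
    \<open>2 * a * R\<close>.\<close>
  define R where "R = (2 * a / c) powr (1 / (r - 1))"
  have R: "R \<ge> 0" by (simp add: R_def)
  define C where "C = exp (2 * a * R) * M powr c"
  have "C \<ge> 1 * 1"
    unfolding C_def using M R \<open>a \<ge> 0\<close> \<open>c > 0\<close> by (intro mult_mono ge_one_powr_ge_zero) auto
  moreover have "exp (a * (t - s)) \<le> C * (\<mu> t / \<mu> s) powr c" if "s \<le> t" for t s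
  proof -
    define g where "g = sgn t * \<bar>t\<bar> powr r - sgn s * \<bar>s\<bar> powr r"
    have g: "g \<ge> ((t - s) / 2) powr r"
      unfolding g_def using signed_powr_increment that r by simp
    then have g0: "g \<ge> 0"
      using powr_ge_zero order.trans by blast
    have "a * (t - s) \<le> c * g + 2 * a * R"
    proof (cases "(t - s) / 2 \<ge> R")
      case True
      have "2 * a / c = R powr (r - 1)"
        using r \<open>a \<ge> 0\<close> \<open>c > 0\<close> by (simp add: R_def powr_powr)
      also have "\<dots> \<le> ((t - s) / 2) powr (r - 1)"
        using True R r by (intro powr_mono2) auto
      finally have "(t - s) / 2 * (2 * a / c) \<le> (t - s) / 2 * ((t - s) / 2) powr (r - 1)"
        using that by (intro mult_left_mono) auto
      also have "\<dots> = ((t - s) / 2) powr r"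
        using that by (cases "s = t") (simp_all add: powr_diff)
      also have "\<dots> \<le> g" by (rule g)
      finally have "a * (t - s) \<le> c * g"
        using \<open>c > 0\<close> by (simp add: field_simps)
      moreover have "2 * a * R \<ge> 0"
        using R \<open>a \<ge> 0\<close> by simp
      ultimately show ?thesis by linarith
    next
      case False
      then have "a * (t - s) \<le> a * (2 * R)"
        using \<open>a \<ge> 0\<close> by (intro mult_left_mono) auto
      moreover have "c * g \<ge> 0"
        using g0 \<open>c > 0\<close> by simp
      ultimately show ?thesis by simp
    qed
    then have "exp (a * (t - s)) \<le> exp (2 * a * R) * exp g powr c"
      by (simp add: exp_powr_real mult.commute flip: exp_add)
    \<comment> \<open>\<open>exp g\<close> is the quotient \<open>s_rate r t / s_rate r s\<close>,
      so fastness of \<open>\<mu>\<close> enters here.\<close>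
    also have "exp g powr c \<le> (M * (\<mu> t / \<mu> s)) powr c"
      using fast[OF that] \<open>c > 0\<close> by (intro powr_mono2) (auto simp: s_rate_def g_def exp_diff)
    also have "\<dots> = M powr c * (\<mu> t / \<mu> s) powr c"
      by (rule powr_mult)
    finally show ?thesis
      by (simp add: C_def mult_ac)
  qed
  ultimately show ?thesis
    by (intro exI[of _ C]) auto
qed


section \<open>Dichotomies and spectra under bounded growth\<close>

lemma uniform_imp_nonuniform_dichotomy:
  "uniform_dichotomy \<mu> B P \<Longrightarrow> nonuniform_dichotomy \<mu> B P"
  unfolding uniform_dichotomy_def nonuniform_dichotomy_def by force

lemma shifted_has_dichotomy_mono:
  assumes "shifted_has_dichotomy D \<mu> \<eta> \<gamma>" "\<And>B P. D B P \<Longrightarrow> D' B P"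
  shows "shifted_has_dichotomy D' \<mu> \<eta> \<gamma>"
  using assms unfolding shifted_has_dichotomy_def by (cases \<gamma>) auto

lemma opnorm_mat_1: "opnorm (mat 1 :: real^'n^'n::finite) = 1"
  by (simp add: opnorm_def onorm_id)

context
  fixes \<mu> :: "real \<Rightarrow> real" and \<eta> :: "'n::finite coeff" and L a :: real
  assumes fast: "fast_growth_rate \<mu>" and \<eta>: "locally_integrable \<eta>"
    and L: "L \<ge> 1" and a: "a > 0"
    and growth: "\<And>t s. opnorm (evolution \<eta> t s) \<le> L * exp (a * \<bar>t - s\<bar>)"
begin

lemmas \<mu> = fast_imp_growth_rate[OF fast]

text \<open>The growth bound is symmetric in the two times, so forward and backward evolution obey
  the same estimate, with an arbitrarily small positive power of the rate.\<close>

lemma evolution_le_rate: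
  assumes "c > 0"
  shows "\<exists>C\<ge>1. \<forall>t s. s \<le> t \<longrightarrow> opnorm (evolution \<eta> t s) \<le> C * (\<mu> t / \<mu> s) powr c \<and>
    opnorm (evolution \<eta> s t) \<le> C * (\<mu> t / \<mu> s) powr c"
proof -
  obtain C where C: "C \<ge> 1" "\<And>t s. s \<le> t \<Longrightarrow> exp (a * (t - s)) \<le> C * (\<mu> t / \<mu> s) powr c"
    using exp_dominated_by_fast_rate[OF fast, of a c] a \<open>c > 0\<close> by auto
  have *: "L * exp (a * (t - s)) \<le> L * C * (\<mu> t / \<mu> s) powr c" if "s \<le> t" for t s
    using mult_left_mono[OF C(2)[OF that], of L] L by (simp only: mult.assoc)
  have "opnorm (evolution \<eta> t s) \<le> L * C * (\<mu> t / \<mu> s) powr c"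
    and "opnorm (evolution \<eta> s t) \<le> L * C * (\<mu> t / \<mu> s) powr c" if "s \<le> t" for t s
    using order.trans[OF growth[of t s]] order.trans[OF growth[of s t]] *[OF that] that by simp_all
  moreover have "L * C \<ge> 1"
    using mult_mono[of 1 L 1 C] L C(1) by simp
  ultimately show ?thesis by blast
qed

text \<open>Half of \<open>\<gamma>\<close> pays for the growth of the unshifted evolution; the
  other half remains as decay.\<close>

lemma uniform_dichotomy_shift_pos:
  assumes "\<gamma> > 0"
  shows "uniform_dichotomy \<mu> (shifted \<mu> \<eta> \<gamma>) (\<lambda>_. mat 1)"
proof -
  note pos = growth_rate_pos[OF \<mu>]
  obtain C where C: "C \<ge> 1" "\<And>t s. s \<le> t \<Longrightarrow> opnorm (evolution \<eta> t s) \<le> C * (\<mu> t / \<mu> s) powr (\<gamma> / 2)"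
    using evolution_le_rate[of "\<gamma> / 2"] \<open>\<gamma> > 0\<close> by auto
  \<comment> \<open>The complementary projector is 0, so the exponent 1 in the second bound is an
    arbitrary positive choice.\<close>
  have "dichotomy_bounds \<mu> (shifted \<mu> \<eta> \<gamma>) (\<lambda>_. mat 1) C (- \<gamma> / 2) 1 0 0"
    unfolding dichotomy_bounds_def
  proof (intro conjI allI impI)
    fix t s :: real
    assume "s \<le> t"
    have "opnorm (evolution (shifted \<mu> \<eta> \<gamma>) t s)
        = (\<mu> t / \<mu> s) powr (- \<gamma>) * opnorm (evolution \<eta> t s)"
      by (simp add: evolution_shifted[OF \<mu> \<eta>] opnorm_scaleR)
    also have "\<dots> \<le> (\<mu> t / \<mu> s) powr (- \<gamma>) * (C * (\<mu> t / \<mu> s) powr (\<gamma> / 2))"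
      using C(2)[OF \<open>s \<le> t\<close>] by (intro mult_left_mono) auto
    also have "\<dots> = C * (\<mu> t / \<mu> s) powr (- \<gamma> / 2)"
      by (simp add: mult.left_commute flip: powr_add)
    finally show "opnorm (evolution (shifted \<mu> \<eta> \<gamma>) t s ** mat 1)
        \<le> C * (\<mu> t / \<mu> s) powr (- \<gamma> / 2) * \<mu> s powr (sgn s * 0)"
      using pos[of s] by simp
  next
    fix t s :: real
    show "opnorm (evolution (shifted \<mu> \<eta> \<gamma>) t s ** (mat 1 - mat 1))
        \<le> C * (\<mu> t / \<mu> s) powr 1 * \<mu> s powr (sgn s * 0)"
      using C(1) by (simp add: opnorm_zero)
  qed
  then show ?thesis
    unfolding uniform_dichotomy_def invariant_projector_def using C(1) \<open>\<gamma> > 0\<close>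
    by (intro conjI exI[of _ C] exI[of _ "- \<gamma> / 2"] exI[of _ 1]) auto
qed

lemma uniform_dichotomy_shift_neg:
  assumes "\<gamma> < 0"
  shows "uniform_dichotomy \<mu> (shifted \<mu> \<eta> \<gamma>) (\<lambda>_. 0)"
proof -
  note pos = growth_rate_pos[OF \<mu>]
  obtain C where C: "C \<ge> 1" "\<And>t s. s \<le> t \<Longrightarrow> opnorm (evolution \<eta> s t) \<le> C * (\<mu> t / \<mu> s) powr (- \<gamma> / 2)"
    using evolution_le_rate[of "- \<gamma> / 2"] \<open>\<gamma> < 0\<close> by auto
  have "dichotomy_bounds \<mu> (shifted \<mu> \<eta> \<gamma>) (\<lambda>_. 0) C (- 1) (- \<gamma> / 2) 0 0"
    unfolding dichotomy_bounds_def
  proof (intro conjI allI impI)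
    fix t s :: real
    show "opnorm (evolution (shifted \<mu> \<eta> \<gamma>) t s ** 0)
        \<le> C * (\<mu> t / \<mu> s) powr (- 1) * \<mu> s powr (sgn s * 0)"
      using C(1) by (simp add: opnorm_zero)
  next
    fix t s :: real
    assume "t \<le> s"
    \<comment> \<open>The growth estimate has the later time \<open>s\<close> in the numerator,
      whereas the dichotomy bound has \<open>t\<close> there.\<close>
    have inv: "(\<mu> s / \<mu> t) powr (- \<gamma> / 2) = (\<mu> t / \<mu> s) powr (\<gamma> / 2)"
      using pos[of s] pos[of t] by (simp add: powr_def ln_div algebra_simps)
    have "opnorm (evolution (shifted \<mu> \<eta> \<gamma>) t s)
        = (\<mu> t / \<mu> s) powr (- \<gamma>) * opnorm (evolution \<eta> t s)"
      by (simp add: evolution_shifted[OF \<mu> \<eta>] opnorm_scaleR)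
    also have "\<dots> \<le> (\<mu> t / \<mu> s) powr (- \<gamma>) * (C * (\<mu> t / \<mu> s) powr (\<gamma> / 2))"
      using C(2)[OF \<open>t \<le> s\<close>] unfolding inv by (intro mult_left_mono) auto
    also have "\<dots> = C * (\<mu> t / \<mu> s) powr (- \<gamma> / 2)"
      by (simp add: mult.left_commute flip: powr_add)
    finally show "opnorm (evolution (shifted \<mu> \<eta> \<gamma>) t s ** (mat 1 - 0))
        \<le> C * (\<mu> t / \<mu> s) powr (- \<gamma> / 2) * \<mu> s powr (sgn s * 0)"
      using pos[of s] by simp
  qed
  then show ?thesis
    unfolding uniform_dichotomy_def invariant_projector_def using C(1) \<open>\<gamma> < 0\<close>
    by (intro conjI exI[of _ C] exI[of _ "- 1"] exI[of _ "- \<gamma> / 2"]) auto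
qed

text \<open>At \<open>s = 0\<close> the nonuniform factor is \<open>1\<close>. Pulling back by \<open>\<Phi>(0,t)\<close>, which is of lower
  order than every power of \<open>\<mu>\<close>, the dichotomy forces both \<open>P(0) = 0\<close> (as \<open>t \<rightarrow> \<infinity>\<close>) and
  \<open>P(0) = Id\<close> (as \<open>t \<rightarrow> -\<infinity>\<close>).\<close>

lemma not_nonuniform_dichotomy: "\<not> nonuniform_dichotomy \<mu> \<eta> P"
proof
  assume "nonuniform_dichotomy \<mu> \<eta> P"
  then obtain K \<alpha> \<beta> \<theta> \<nu> where K: "K \<ge> 1" "\<alpha> < 0" "\<beta> > 0"
    and bounds: "dichotomy_bounds \<mu> \<eta> P K \<alpha> \<beta> \<theta> \<nu>"
    unfolding nonuniform_dichotomy_def by blast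
  note pos = growth_rate_pos[OF \<mu>]
  have \<mu>0: "\<mu> 0 = 1" using \<mu> by (simp add: growth_rate_def)
  have fwd: "opnorm (evolution \<eta> t 0 ** P 0) \<le> K * \<mu> t powr \<alpha>" if "t \<ge> 0" for t
  proof -
    have "opnorm (evolution \<eta> t 0 ** P 0) \<le> K * (\<mu> t / \<mu> 0) powr \<alpha> * \<mu> 0 powr (sgn 0 * \<theta>)"
      using bounds that unfolding dichotomy_bounds_def by blast
    then show ?thesis by (simp add: \<mu>0)
  qed
  have bwd: "opnorm (evolution \<eta> t 0 ** (mat 1 - P 0)) \<le> K * \<mu> t powr \<beta>" if "t \<le> 0" for t
  proof -
    have "opnorm (evolution \<eta> t 0 ** (mat 1 - P 0)) \<le> K * (\<mu> t / \<mu> 0) powr \<beta> * \<mu> 0 powr (sgn 0 * \<nu>)"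
      using bounds that unfolding dichotomy_bounds_def by blast
    then show ?thesis by (simp add: \<mu>0)
  qed
  have pull: "opnorm Q \<le> opnorm (evolution \<eta> 0 t) * opnorm (evolution \<eta> t 0 ** Q)" for t Q
    using opnorm_mult[of "evolution \<eta> 0 t" "evolution \<eta> t 0 ** Q"]
    by (simp add: matrix_mul_assoc evolution_cocycle[OF \<eta>] evolution_refl[OF \<eta>])
  have "opnorm (P 0) \<le> 0"
  proof -
    \<comment> \<open>Spending \<open>- \<alpha> / 2\<close> on the pull-back leaves the negative
      exponent \<open>\<alpha> / 2\<close>, so the bound vanishes as \<open>\<mu> t\<close> tends to
      infinity.\<close>
    obtain C where C: "C \<ge> 1" "\<And>t s. s \<le> t \<Longrightarrow> opnorm (evolution \<eta> s t) \<le> C * (\<mu> t / \<mu> s) powr (- \<alpha> / 2)"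
      using evolution_le_rate[of "- \<alpha> / 2"] K by auto
    have "opnorm (P 0) \<le> C * K * \<mu> t powr (\<alpha> / 2)" if "t \<ge> 0" for t
    proof -
      have "opnorm (P 0) \<le> opnorm (evolution \<eta> 0 t) * opnorm (evolution \<eta> t 0 ** P 0)"
        by (rule pull)
      also have "\<dots> \<le> (C * \<mu> t powr (- \<alpha> / 2)) * (K * \<mu> t powr \<alpha>)"
        using C(2)[OF that] fwd[OF that] C(1) by (intro mult_mono) (simp_all add: \<mu>0 opnorm_nonneg)
      also have "\<dots> = C * K * (\<mu> t powr (- \<alpha> / 2) * \<mu> t powr \<alpha>)"
        by (simp add: mult_ac)
      also have "\<mu> t powr (- \<alpha> / 2) * \<mu> t powr \<alpha> = \<mu> t powr (\<alpha> / 2)"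
        by (simp flip: powr_add)
      finally show ?thesis .
    qed
    then have "\<forall>\<^sub>F t in at_top. opnorm (P 0) \<le> C * K * \<mu> t powr (\<alpha> / 2)"
      by (intro eventually_mono[OF eventually_ge_at_top[of 0]])
    moreover have "((\<lambda>t. C * K * \<mu> t powr (\<alpha> / 2)) \<longlongrightarrow> C * K * 0) at_top"
      using \<mu> K by (intro tendsto_mult tendsto_const tendsto_neg_powr) (auto simp: growth_rate_def)
    ultimately show ?thesis
      using tendsto_lowerbound[of "\<lambda>t. C * K * \<mu> t powr (\<alpha> / 2)" "C * K * 0" at_top "opnorm (P 0)"]
      by simp
  qed
  moreover have "opnorm (mat 1 - P 0) \<le> 0"
  proof -
    \<comment> \<open>At the other end the exponent left over is \<open>\<beta> / 2 > 0\<close>, and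
      \<open>\<mu> t\<close> tends to 0.\<close>
    obtain C where C: "C \<ge> 1" "\<And>t s. s \<le> t \<Longrightarrow> opnorm (evolution \<eta> t s) \<le> C * (\<mu> t / \<mu> s) powr (\<beta> / 2)"
      using evolution_le_rate[of "\<beta> / 2"] K by auto
    have "opnorm (mat 1 - P 0) \<le> C * K * \<mu> t powr (\<beta> / 2)" if "t \<le> 0" for t
    proof -
      have "opnorm (mat 1 - P 0) \<le> opnorm (evolution \<eta> 0 t) * opnorm (evolution \<eta> t 0 ** (mat 1 - P 0))"
        by (rule pull)
      also have "\<dots> \<le> (C * (1 / \<mu> t) powr (\<beta> / 2)) * (K * \<mu> t powr \<beta>)"
        using C(2)[OF that] bwd[OF that] C(1) by (intro mult_mono) (simp_all add: \<mu>0 opnorm_nonneg)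
      also have "\<dots> = C * K * ((1 / \<mu> t) powr (\<beta> / 2) * \<mu> t powr \<beta>)"
        by (simp add: mult_ac)
      also have "(1 / \<mu> t) powr (\<beta> / 2) = \<mu> t powr (- \<beta> / 2)"
        using pos[of t] by (simp add: powr_def ln_div)
      also have "\<mu> t powr (- \<beta> / 2) * \<mu> t powr \<beta> = \<mu> t powr (\<beta> / 2)"
        by (simp flip: powr_add)
      finally show ?thesis .
    qed
    then have "\<forall>\<^sub>F t in at_bot. opnorm (mat 1 - P 0) \<le> C * K * \<mu> t powr (\<beta> / 2)"
      by (intro eventually_mono[OF eventually_le_at_bot[of 0]])
    moreover have "((\<lambda>t. C * K * \<mu> t powr (\<beta> / 2)) \<longlongrightarrow> C * K * 0) at_bot"
      using \<mu> K
      by (intro tendsto_mult tendsto_const tendsto_zero_powrI[where b = "\<beta> / 2"])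
         (auto simp: growth_rate_def less_imp_le)
    ultimately show ?thesis
      using tendsto_lowerbound[of "\<lambda>t. C * K * \<mu> t powr (\<beta> / 2)" "C * K * 0" at_bot "opnorm (mat 1 - P 0)"]
      by simp
  qed
  ultimately have "P 0 = 0" "mat 1 - P 0 = 0"
    by (metis opnorm_eq_0 opnorm_nonneg order.antisym)+
  then show False
    using opnorm_mat_1[where 'n = 'n] by (simp add: opnorm_zero)
qed

text \<open>A uniform dichotomy is also nonuniform, so the nonuniform spectrum lies in the uniform
  one. The latter is contained in \<open>{0}\<close>, and 0 belongs to the former because the shift
  by 0 leaves the equation unchanged.\<close>

lemma spectra_fast_rate:
  "spectrum_NmuD \<mu> \<eta> = {0}" "spectrum_muD \<mu> \<eta> = {0}"
proof -
  have shift0: "shifted \<mu> \<eta> 0 = \<eta>"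
    by (simp add: shifted_def)
  have "\<not> shifted_has_dichotomy (nonuniform_dichotomy \<mu>) \<mu> \<eta> 0"
    using not_nonuniform_dichotomy by (simp add: shifted_has_dichotomy_def shift0 zero_ereal_def)
  moreover have "shifted_has_dichotomy (uniform_dichotomy \<mu>) \<mu> \<eta> \<gamma>" if "\<gamma> \<noteq> 0" for \<gamma>
  proof (cases \<gamma>)
    case (real g)
    then show ?thesis
      using that uniform_dichotomy_shift_pos[of g] uniform_dichotomy_shift_neg[of g]
      by (cases "g > 0") (auto simp: shifted_has_dichotomy_def zero_ereal_def)
  next
    \<comment> \<open>At infinite parameters one finite shift with the trivial projector suffices; 1
      and -1 serve for the two signs.\<close>
    case PInf
    then show ?thesis
      using uniform_dichotomy_shift_pos[of 1] by (auto simp: shifted_has_dichotomy_def)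
  next
    case MInf
    then show ?thesis
      using uniform_dichotomy_shift_neg[of "-1"] by (auto simp: shifted_has_dichotomy_def)
  qed
  moreover have "shifted_has_dichotomy (nonuniform_dichotomy \<mu>) \<mu> \<eta> \<gamma>"
    if "shifted_has_dichotomy (uniform_dichotomy \<mu>) \<mu> \<eta> \<gamma>" for \<gamma>
    using that by (rule shifted_has_dichotomy_mono) (rule uniform_imp_nonuniform_dichotomy)
  ultimately show "spectrum_NmuD \<mu> \<eta> = {0}" "spectrum_muD \<mu> \<eta> = {0}"
    unfolding spectrum_NmuD_def spectrum_muD_def by auto
qed

end

theorem proposition4p10:
  fixes \<Omega> :: "('n::finite coeff) topology"
    and \<mu> :: "real \<Rightarrow> real"
    and \<omega> :: "'n coeff"
  assumes "base_space \<Omega>"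
    and "fast_growth_rate \<mu>"
    and "\<omega> \<in> topspace \<Omega>"
    and "exp_bounded_growth \<omega>"
  shows "\<forall>\<eta>\<in>orbit_hull \<Omega> \<omega>.
           spectrum_NmuD \<mu> \<eta> = spectrum_muD \<mu> \<eta> \<and> spectrum_muD \<mu> \<eta> = {0}"
proof
  fix \<eta>
  assume \<eta>: "\<eta> \<in> orbit_hull \<Omega> \<omega>"
  obtain L a where L: "L \<ge> 1" and a: "a > 0"
    and growth: "\<And>t s. opnorm (Phi \<omega> t s) \<le> L * exp (a * \<bar>t - s\<bar>)"
    using assms(4) unfolding exp_bounded_growth_def by blast
  have "\<eta> \<in> topspace \<Omega>"
    using \<eta> closure_of_subset_topspace[of \<Omega>] unfolding orbit_hull_def by (rule rev_subsetD)
  then have "locally_integrable \<eta>"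
    using assms(1) by (simp add: base_space_def)
  moreover have "opnorm (evolution \<eta> t s) \<le> L * exp (a * \<bar>t - s\<bar>)" for t s
    using bounded_growth_hull[OF assms(1,3) \<eta> _ growth] L by (simp add: Phi_eq_evolution)
  ultimately have "spectrum_NmuD \<mu> \<eta> = {0}" "spectrum_muD \<mu> \<eta> = {0}"
    by (rule spectra_fast_rate[OF assms(2) _ L a])+
  then show "spectrum_NmuD \<mu> \<eta> = spectrum_muD \<mu> \<eta> \<and> spectrum_muD \<mu> \<eta> = {0}"
    by simp
qed

end
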